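(* Let $V$ and $V_*$ be countable-dimensional complex vector spaces (of infinite dimension) with a nondegenerate pairing $\langle\cdot,\cdot\rangle:V\times V_*\to\mathbb{C}$. A subalgebra of $\mathfrak{sl}(V,V_* )$ is a Borel subalgebra if and only if it is the stabilizer in $\mathfrak{sl}(V,V_* )$ of a maximal closed generalized flag in $V$. Furthermore, the map $\mathfrak F\mapsto\mathrm{St}_{\mathfrak F}$ is a bijection between maximal closed generalized flags in $V$ and Borel subalgebras of $\mathfrak{sl}(V,V_* )$.
   Context: $\mathfrak{gl}(V,V_* )$ is the Lie algebra of the associative algebra $V\otimes V_*$ with $(v\otimes w)(v'\otimes w')=\langle v',w\rangle v\otimes w'$, acting on $V$ by $(v\otimes w)\cdot u=\langle u,w\rangle v$; $\mathfrak{sl}(V,V_* )=[\mathfrak{gl}(V,V_* ),\mathfrak{gl}(V,V_* )]$ is its traceless part (trace: $v\otimes w\mapsto\langle v,w\rangle$). A locally finite Lie algebra (every finite subset lies in a finite-dimensional subalgebra) is locally solvable if every finite subset is contained in a solvable subalgebra. A Borel subalgebra is a maximal locally solvable subalgebra. A generalized flag $\mathfrak F$ in a vector space $X$ is a set of subspaces totally ordered by inclusion such that each $F\in\mathfrak F$ has an immediate predecessor or an immediate successor in $\mathfrak F$, and for every nonzero $x\in X$ there is an immediate predecessor-successor pair $F'_x\subset F''_x$ in $\mathfrak F$ with $x\in F''_x\setminus F'_x$. A generalized flag $\mathfrak G$ refines $\mathfrak F$ if $F'_x\subset G'_x\subset G''_x\subset F''_x$ for all nonzero $x$. The closure of a subspace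 $F\subseteq V$ is $\overline F=F^{\perp\perp}$ with respect to the pairing; $F$ is closed if $F=\overline F$. A generalized flag in $V$ is closed if every immediate successor is closed and every immediate predecessor has as its closure either itself or its immediate successor (equivalently $\mathfrak F=\mathrm{fl}(\{F^{\perp\perp}\}_{F\in\mathfrak F})$, where $\mathrm{fl}(\mathcal C)=\{\bigcup_{x\notin C\in\mathcal C}C,\ \bigcap_{x\in C\in\mathcal C}C\}_{0\ne x\in V}$). A good pair of a closed generalized flag is an immediate predecessor-successor pair whose predecessor is closed. A closed generalized flag is a maximal closed generalized flag (with respect to refinement among closed generalized flags) if and only if every good pair $F'\subset F''$ satisfies $\dim F''/F'=1$. $\mathrm{St}_{\mathfrak F}=\{X\in\mathfrak{sl}(V,V_* ): X\cdot F\subseteq F\ \forall F\in\mathfrak F\}$ is the stabilizer. *)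

theory Defs
  imports Complex_Main "HOL-Library.Poly_Mapping" "HOL-Library.Countable_Set"
begin

class cvector = ab_group_add +
  fixes cscale :: "complex \<Rightarrow> 'a \<Rightarrow> 'a" (infixr \<open>*\<^sub>C\<close> 75)
  assumes cscale_add_right: "a *\<^sub>C (x + y) = a *\<^sub>C x + a *\<^sub>C y"
    and cscale_add_left: "(a + b) *\<^sub>C x = a *\<^sub>C x + b *\<^sub>C x"
    and cscale_cscale: "a *\<^sub>C (b *\<^sub>C x) = (a * b) *\<^sub>C x"
    and cscale_one: "1 *\<^sub>C x = x"

global_interpretation cvec: vector_space "cscale :: complex \<Rightarrow> 'a \<Rightarrow> 'a::cvector"
  by standard (rule cscale_add_right cscale_add_left cscale_cscale cscale_one)+

instantiation complex :: cvector
begin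
definition cscale_complex_def: "c *\<^sub>C (z::complex) = c * z"
instance by standard (simp_all add: cscale_complex_def algebra_simps)
end

instantiation poly_mapping :: (type, cvector) cvector
begin
definition cscale_poly_mapping_def: "c *\<^sub>C f = Poly_Mapping.map (cscale c) f"
instance
proof -
  have lk: "Poly_Mapping.lookup (Poly_Mapping.map (cscale c) f) k = c *\<^sub>C Poly_Mapping.lookup f k"
    for c and f :: "'a \<Rightarrow>\<^sub>0 'b" and k
    by (simp add: Poly_Mapping.map.rep_eq when_def)
  show "OFCLASS('a \<Rightarrow>\<^sub>0 'b, cvector_class)"
    by standard
      (auto intro!: poly_mapping_eqI simp: cscale_poly_mapping_def lk lookup_add
        cscale_add_right cscale_add_left cscale_cscale cscale_one)
qed
end

lemma lookup_cscale: "Poly_Mapping.lookup (c *\<^sub>C f) k = c *\<^sub>C Poly_Mapping.lookup f k"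
  by (simp add: cscale_poly_mapping_def Poly_Mapping.map.rep_eq when_def)

abbreviation clinear :: "('a::cvector \<Rightarrow> 'b::cvector) \<Rightarrow> bool"
  where "clinear \<equiv> Vector_Spaces.linear cscale cscale"

lemma clinear_iff:
  "clinear f \<longleftrightarrow> (\<forall>x y. f (x + y) = f x + f y) \<and> (\<forall>c x. f (c *\<^sub>C x) = c *\<^sub>C f x)"
  by (simp add: linear_iff_module_hom module_hom_iff cvec.module_axioms)

definition cbilinear :: "('a::cvector \<Rightarrow> 'b::cvector \<Rightarrow> 'c::cvector) \<Rightarrow> bool"
  where "cbilinear \<beta> \<longleftrightarrow> (\<forall>w. clinear (\<lambda>v. \<beta> v w)) \<and> (\<forall>v. clinear (\<beta> v))"

lemma cbilinear_iff:
  "cbilinear \<beta> \<longleftrightarrow>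
    (\<forall>v v' w. \<beta> (v + v') w = \<beta> v w + \<beta> v' w) \<and> (\<forall>c v w. \<beta> (c *\<^sub>C v) w = c *\<^sub>C \<beta> v w) \<and>
    (\<forall>v w w'. \<beta> v (w + w') = \<beta> v w + \<beta> v w') \<and> (\<forall>c v w. \<beta> v (c *\<^sub>C w) = c *\<^sub>C \<beta> v w)"
  unfolding cbilinear_def clinear_iff by blast

definition countably_infinite_dim :: "'a::cvector set \<Rightarrow> bool"
  where "countably_infinite_dim S \<longleftrightarrow>
    (\<exists>B. cvec.independent B \<and> cvec.span B = S \<and> countable B \<and> infinite B)"

definition finite_dim :: "'a::cvector set \<Rightarrow> bool"
  where "finite_dim S \<longleftrightarrow> (\<exists>B. finite B \<and> cvec.span B = S)"

text \<open>The quotient of the free vector space on pairs by the bilinearity relations.\<close>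

definition tensor_relators :: "('v::cvector \<times> 'w::cvector \<Rightarrow>\<^sub>0 complex) set" where
  "tensor_relators =
     {Poly_Mapping.single (v + v', w) 1 - Poly_Mapping.single (v, w) 1
        - Poly_Mapping.single (v', w) 1 | v v' w. True} \<union>
     {Poly_Mapping.single (v, w + w') 1 - Poly_Mapping.single (v, w) 1
        - Poly_Mapping.single (v, w') 1 | v w w'. True} \<union>
     {Poly_Mapping.single (c *\<^sub>C v, w) 1 - c *\<^sub>C Poly_Mapping.single (v, w) 1 | c v w. True} \<union>
     {Poly_Mapping.single (v, c *\<^sub>C w) 1 - c *\<^sub>C Poly_Mapping.single (v, w) 1 | c v w. True}"

definition tensor_eq ::
    "('v::cvector \<times> 'w::cvector \<Rightarrow>\<^sub>0 complex) \<Rightarrow> ('v \<times> 'w \<Rightarrow>\<^sub>0 complex) \<Rightarrow> bool"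
  where "tensor_eq f g \<longleftrightarrow> f - g \<in> cvec.span tensor_relators"

lemma equivp_tensor_eq:
  "equivp (tensor_eq :: ('v::cvector \<times> 'w::cvector \<Rightarrow>\<^sub>0 complex) \<Rightarrow> _)"
  (is "equivp ?R")
proof (rule equivpI)
  show "reflp ?R"
    by (simp add: reflp_def tensor_eq_def cvec.span_zero)
  show "symp ?R"
    unfolding symp_def tensor_eq_def by (metis cvec.span_neg minus_diff_eq)
  show "transp ?R"
  proof (rule transpI)
    fix f g h :: "'v \<times> 'w \<Rightarrow>\<^sub>0 complex"
    assume "tensor_eq f g" "tensor_eq g h"
    then have "(f - g) + (g - h) \<in> cvec.span tensor_relators"
      unfolding tensor_eq_def by (rule cvec.span_add)
    then show "tensor_eq f h" by (simp add: tensor_eq_def)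
  qed
qed

quotient_type (overloaded) ('v, 'w) tensor =
    "('v::cvector \<times> 'w::cvector) \<Rightarrow>\<^sub>0 complex" / tensor_eq
  by (rule equivp_tensor_eq)

instantiation tensor :: (cvector, cvector) cvector
begin

lift_definition zero_tensor :: "('a, 'b) tensor" is 0 .

lift_definition plus_tensor :: "('a, 'b) tensor \<Rightarrow> ('a, 'b) tensor \<Rightarrow> ('a, 'b) tensor" is "(+)"
  unfolding tensor_eq_def by (metis add_diff_add cvec.span_add)

lift_definition uminus_tensor :: "('a, 'b) tensor \<Rightarrow> ('a, 'b) tensor" is uminus
  unfolding tensor_eq_def by (metis cvec.span_neg minus_diff_minus)

lift_definition minus_tensor :: "('a, 'b) tensor \<Rightarrow> ('a, 'b) tensor \<Rightarrow> ('a, 'b) tensor" is "(-)"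
proof -
  fix f f' g g' :: "'a \<times> 'b \<Rightarrow>\<^sub>0 complex"
  assume "tensor_eq f f'" "tensor_eq g g'"
  then have "(f - f') - (g - g') \<in> cvec.span tensor_relators"
    unfolding tensor_eq_def by (rule cvec.span_diff)
  then show "tensor_eq (f - g) (f' - g')"
    by (simp add: tensor_eq_def algebra_simps)
qed

lift_definition cscale_tensor :: "complex \<Rightarrow> ('a, 'b) tensor \<Rightarrow> ('a, 'b) tensor" is cscale
  unfolding tensor_eq_def by (metis cvec.scale_right_diff_distrib cvec.span_scale)

instance
proof
  have tensor_eqI: "tensor_eq f g" if "f = g" for f g :: "'a \<times> 'b \<Rightarrow>\<^sub>0 complex"
    using that by (simp add: tensor_eq_def cvec.span_zero)
  fix x y z :: "('a, 'b) tensor" and a b :: complex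
  show "x + y + z = x + (y + z)" by transfer (simp add: tensor_eqI algebra_simps)
  show "x + y = y + x" by transfer (simp add: tensor_eqI algebra_simps)
  show "0 + x = x" by transfer (simp add: tensor_eqI)
  show "- x + x = 0" by transfer (simp add: tensor_eqI)
  show "x - y = x + - y" by transfer (simp add: tensor_eqI)
  show "a *\<^sub>C (x + y) = a *\<^sub>C x + a *\<^sub>C y"
    by transfer (simp add: tensor_eqI cscale_add_right)
  show "(a + b) *\<^sub>C x = a *\<^sub>C x + b *\<^sub>C x"
    by transfer (simp add: tensor_eqI cscale_add_left)
  show "a *\<^sub>C (b *\<^sub>C x) = (a * b) *\<^sub>C x"
    by transfer (simp add: tensor_eqI cscale_cscale)
  show "1 *\<^sub>C x = x" by transfer (simp add: tensor_eqI cscale_one)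
qed

end

lift_definition tens :: "'v::cvector \<Rightarrow> 'w::cvector \<Rightarrow> ('v, 'w) tensor"  (infixl \<open>\<otimes>\<^sub>t\<close> 77)
  is "\<lambda>v w. Poly_Mapping.single (v, w) 1" .

definition free_lift ::
    "('v \<Rightarrow> 'w \<Rightarrow> 'u::cvector) \<Rightarrow> ('v \<times> 'w \<Rightarrow>\<^sub>0 complex) \<Rightarrow> 'u"
  where "free_lift \<beta> f = (\<Sum>(v, w)\<in>Poly_Mapping.keys f. Poly_Mapping.lookup f (v, w) *\<^sub>C \<beta> v w)"

text \<open>The linear map induced by a bilinear map. The chosen representative does not matter when
  \<open>\<beta>\<close> is bilinear (lemmas \<open>clinear_tensor_lift\<close> and \<open>tensor_lift_tens\<close>); otherwise the value is
  meaningless.\<close>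

definition tensor_lift ::
    "('v::cvector \<Rightarrow> 'w::cvector \<Rightarrow> 'u::cvector) \<Rightarrow> ('v, 'w) tensor \<Rightarrow> 'u"
  where "tensor_lift \<beta> x = free_lift \<beta> (rep_tensor x)"

lemma free_lift_superset:
  assumes "finite K" "Poly_Mapping.keys f \<subseteq> K"
  shows "free_lift \<beta> f = (\<Sum>(v, w)\<in>K. Poly_Mapping.lookup f (v, w) *\<^sub>C \<beta> v w)"
  unfolding free_lift_def using assms
  by (intro sum.mono_neutral_left) (auto simp: in_keys_iff)

lemma clinear_free_lift: "clinear (free_lift \<beta>)"
  unfolding clinear_iff
proof (intro conjI allI)
  fix f g :: "'a \<times> 'b \<Rightarrow>\<^sub>0 complex" and c :: complex
  let ?K = "Poly_Mapping.keys f \<union> Poly_Mapping.keys g"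
  have K: "Poly_Mapping.keys (f + g) \<subseteq> ?K" by (rule keys_add)
  show "free_lift \<beta> (f + g) = free_lift \<beta> f + free_lift \<beta> g"
    by (simp add: free_lift_superset[of ?K] K lookup_add cscale_add_left
        sum.distrib split_def)
  have C: "Poly_Mapping.keys (c *\<^sub>C f) \<subseteq> Poly_Mapping.keys f"
    by (auto simp: in_keys_iff lookup_cscale)
  show "free_lift \<beta> (c *\<^sub>C f) = c *\<^sub>C free_lift \<beta> f"
    by (simp add: free_lift_superset[OF _ C] free_lift_def[of _ f] lookup_cscale
        cscale_complex_def cvec.scale_sum_right split_def)
qed

lemma free_lift_single: "free_lift \<beta> (Poly_Mapping.single (v, w) c) = c *\<^sub>C \<beta> v w"
  by (simp add: free_lift_superset[of "{(v, w)}"])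

lemma free_lift_cong:
  assumes "cbilinear \<beta>" "tensor_eq f g"
  shows "free_lift \<beta> f = free_lift \<beta> g"
proof -
  interpret L: Vector_Spaces.linear cscale cscale "free_lift \<beta>" by (rule clinear_free_lift)
  have rel: "free_lift \<beta> r = 0" if "r \<in> tensor_relators" for r
    using that assms(1) unfolding tensor_relators_def
    by (auto simp: L.diff L.scale free_lift_single cscale_one cbilinear_iff)
  have "free_lift \<beta> (f - g) = 0"
    by (rule L.eq_0_on_span[OF rel]) (use assms(2) in \<open>simp_all add: tensor_eq_def\<close>)
  then show ?thesis by (simp add: L.diff)
qed

lemma tensor_lift_abs:
  assumes "cbilinear \<beta>"
  shows "tensor_lift \<beta> (abs_tensor f) = free_lift \<beta> f"
  unfolding tensor_lift_def
  by (rule free_lift_cong[OF assms])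
    (rule rep_abs_rsp_left [OF Quotient3_tensor], rule equivp_reflp [OF equivp_tensor_eq])

lemma clinear_tensor_lift:
  assumes "cbilinear \<beta>"
  shows "clinear (tensor_lift \<beta>)"
proof -
  interpret L: Vector_Spaces.linear cscale cscale "free_lift \<beta>" by (rule clinear_free_lift)
  show ?thesis unfolding clinear_iff
  proof (intro conjI allI)
    fix x y :: "('a, 'b) tensor" and c :: complex
    obtain f g where fg: "x = abs_tensor f" "y = abs_tensor g"
      using Quotient3_abs_rep [OF Quotient3_tensor] by metis
    show "tensor_lift \<beta> (x + y) = tensor_lift \<beta> x + tensor_lift \<beta> y"
      by (simp add: fg plus_tensor.abs_eq tensor_lift_abs[OF assms] L.add)
    show "tensor_lift \<beta> (c *\<^sub>C x) = c *\<^sub>C tensor_lift \<beta> x"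
      by (simp add: fg cscale_tensor.abs_eq tensor_lift_abs[OF assms] L.scale)
  qed
qed

lemma tensor_lift_tens:
  assumes "cbilinear \<beta>"
  shows "tensor_lift \<beta> (v \<otimes>\<^sub>t w) = \<beta> v w"
  by (simp add: tens.abs_eq tensor_lift_abs[OF assms] free_lift_single cscale_one)

lemma cbilinear_tens: "cbilinear (\<otimes>\<^sub>t)"
proof -
  have *: "tensor_eq f g" if "f - g \<in> tensor_relators" for f g :: "'a \<times> 'b \<Rightarrow>\<^sub>0 complex"
    using that by (simp add: tensor_eq_def cvec.span_base)
  show ?thesis
    unfolding cbilinear_iff
    by (intro conjI allI; transfer; rule *; unfold tensor_relators_def diff_diff_add [symmetric];
        blast)
qed

lemma tensor_lift_add_fun:
  "tensor_lift (\<lambda>v w. \<beta> v w + \<gamma> v w) x = tensor_lift \<beta> x + tensor_lift \<gamma> x"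
  by (simp add: tensor_lift_def free_lift_def split_def cscale_add_right sum.distrib)

lemma tensor_lift_scale_fun:
  "tensor_lift (\<lambda>v w. c *\<^sub>C \<beta> v w) x = c *\<^sub>C tensor_lift \<beta> x"
  by (simp add: tensor_lift_def free_lift_def split_def cvec.scale_sum_right mult.commute)

definition lie_subalgebra :: "('a::cvector \<Rightarrow> 'a \<Rightarrow> 'a) \<Rightarrow> 'a set \<Rightarrow> bool"
  where "lie_subalgebra br L \<longleftrightarrow> cvec.subspace L \<and> (\<forall>x\<in>L. \<forall>y\<in>L. br x y \<in> L)"

definition derived_algebra :: "('a::cvector \<Rightarrow> 'a \<Rightarrow> 'a) \<Rightarrow> 'a set \<Rightarrow> 'a set"
  where "derived_algebra br L = cvec.span {br x y | x y. x \<in> L \<and> y \<in> L}"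

definition solvable_algebra :: "('a::cvector \<Rightarrow> 'a \<Rightarrow> 'a) \<Rightarrow> 'a set \<Rightarrow> bool"
  where "solvable_algebra br L \<longleftrightarrow> (\<exists>n. (derived_algebra br ^^ n) L = {0})"

definition locally_finite_algebra :: "('a::cvector \<Rightarrow> 'a \<Rightarrow> 'a) \<Rightarrow> 'a set \<Rightarrow> bool"
  where "locally_finite_algebra br L \<longleftrightarrow> lie_subalgebra br L \<and>
    (\<forall>S. finite S \<and> S \<subseteq> L \<longrightarrow>
      (\<exists>H. lie_subalgebra br H \<and> H \<subseteq> L \<and> S \<subseteq> H \<and> finite_dim H))"

definition locally_solvable_algebra :: "('a::cvector \<Rightarrow> 'a \<Rightarrow> 'a) \<Rightarrow> 'a set \<Rightarrow> bool"
  where "locally_solvable_algebra br L \<longleftrightarrow> locally_finite_algebra br L \<and>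
    (\<forall>S. finite S \<and> S \<subseteq> L \<longrightarrow>
      (\<exists>H. lie_subalgebra br H \<and> H \<subseteq> L \<and> S \<subseteq> H \<and> solvable_algebra br H))"

definition borel_subalgebra :: "('a::cvector \<Rightarrow> 'a \<Rightarrow> 'a) \<Rightarrow> 'a set \<Rightarrow> 'a set \<Rightarrow> bool"
  where "borel_subalgebra br g B \<longleftrightarrow>
    lie_subalgebra br B \<and> B \<subseteq> g \<and> locally_solvable_algebra br B \<and>
    (\<forall>B'. lie_subalgebra br B' \<and> B' \<subseteq> g \<and> locally_solvable_algebra br B' \<and> B \<subseteq> B' \<longrightarrow> B' = B)"

definition nondegenerate_pairing :: "('v::cvector \<Rightarrow> 'w::cvector \<Rightarrow> complex) \<Rightarrow> bool"
  where "nondegenerate_pairing p \<longleftrightarrow> cbilinear p \<and>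
    (\<forall>v. (\<forall>w. p v w = 0) \<longrightarrow> v = 0) \<and> (\<forall>w. (\<forall>v. p v w = 0) \<longrightarrow> w = 0)"

definition gl_mult :: "('v::cvector \<Rightarrow> 'w::cvector \<Rightarrow> complex) \<Rightarrow>
    ('v, 'w) tensor \<Rightarrow> ('v, 'w) tensor \<Rightarrow> ('v, 'w) tensor"
  where "gl_mult p x y =
    tensor_lift (\<lambda>v w. tensor_lift (\<lambda>v' w'. p v' w *\<^sub>C (v \<otimes>\<^sub>t w')) y) x"

definition gl_act :: "('v::cvector \<Rightarrow> 'w::cvector \<Rightarrow> complex) \<Rightarrow> ('v, 'w) tensor \<Rightarrow> 'v \<Rightarrow> 'v"
  where "gl_act p x u = tensor_lift (\<lambda>v w. p u w *\<^sub>C v) x"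

lemma tens_simps:
  "(v + v') \<otimes>\<^sub>t w = v \<otimes>\<^sub>t w + v' \<otimes>\<^sub>t w" "(c *\<^sub>C v) \<otimes>\<^sub>t w = c *\<^sub>C (v \<otimes>\<^sub>t w)"
  "v \<otimes>\<^sub>t (w + w') = v \<otimes>\<^sub>t w + v \<otimes>\<^sub>t w'" "v \<otimes>\<^sub>t (c *\<^sub>C w) = c *\<^sub>C (v \<otimes>\<^sub>t w)"
  using cbilinear_tens unfolding cbilinear_iff by blast+

lemma cbilinear_gl_mult_inner:
  fixes p :: "'v::cvector \<Rightarrow> 'w::cvector \<Rightarrow> complex" and v :: 'v
  assumes "cbilinear p"
  shows "cbilinear (\<lambda>v' w'. p v' w *\<^sub>C (v \<otimes>\<^sub>t w'))"
  using assms unfolding cbilinear_iff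
  by (simp add: tens_simps cscale_complex_def cscale_add_left cscale_add_right cscale_cscale
      mult.commute)

lemma cbilinear_gl_mult_outer:
  fixes p :: "'v::cvector \<Rightarrow> 'w::cvector \<Rightarrow> complex" and y :: "('v, 'w) tensor"
  assumes "cbilinear p"
  shows "cbilinear (\<lambda>v w. tensor_lift (\<lambda>v' w'. p v' w *\<^sub>C (v \<otimes>\<^sub>t w')) y)"
  using assms unfolding cbilinear_iff
  by (simp add: tens_simps cscale_complex_def cscale_add_left cscale_add_right cscale_cscale
      mult.commute tensor_lift_add_fun flip: tensor_lift_scale_fun)

lemma gl_mult_tens:
  assumes "cbilinear p"
  shows "gl_mult p (v \<otimes>\<^sub>t w) (v' \<otimes>\<^sub>t w') = p v' w *\<^sub>C (v \<otimes>\<^sub>t w')"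
  unfolding gl_mult_def tensor_lift_tens [OF cbilinear_gl_mult_outer [OF assms]]
  by (rule tensor_lift_tens [OF cbilinear_gl_mult_inner [OF assms]])

lemma cbilinear_gl_mult:
  fixes p :: "'v::cvector \<Rightarrow> 'w::cvector \<Rightarrow> complex"
  assumes "cbilinear p"
  shows "cbilinear (gl_mult p)"
proof -
  have l: "clinear (\<lambda>x. gl_mult p x y)" for y
    unfolding gl_mult_def by (rule clinear_tensor_lift [OF cbilinear_gl_mult_outer [OF assms]])
  have i: "clinear (tensor_lift (\<lambda>v' w'. p v' w *\<^sub>C (v \<otimes>\<^sub>t w')))" for w and v :: 'v
    by (rule clinear_tensor_lift [OF cbilinear_gl_mult_inner [OF assms]])
  note i = i [unfolded clinear_iff]
  have r: "clinear (gl_mult p x)" for x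
    unfolding clinear_iff gl_mult_def
    by (simp add: i [THEN conjunct1, rule_format] i [THEN conjunct2, rule_format]
        tensor_lift_add_fun tensor_lift_scale_fun)
  show ?thesis using l r by (simp add: cbilinear_def)
qed

lemma cbilinear_gl_act_aux:
  assumes "cbilinear p"
  shows "cbilinear (\<lambda>v w. p u w *\<^sub>C v)"
  using assms unfolding cbilinear_iff
  by (auto simp: cscale_complex_def cscale_add_left cscale_add_right cscale_cscale mult.commute)

lemma gl_act_tens:
  assumes "cbilinear p"
  shows "gl_act p (v \<otimes>\<^sub>t w) u = p u w *\<^sub>C v"
  by (simp add: gl_act_def tensor_lift_tens cbilinear_gl_act_aux assms)

lemma clinear_gl_act:
  assumes "cbilinear p"
  shows "clinear (\<lambda>x. gl_act p x u)"
  unfolding gl_act_def by (rule clinear_tensor_lift, rule cbilinear_gl_act_aux, rule assms)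

definition gl_bracket :: "('v::cvector \<Rightarrow> 'w::cvector \<Rightarrow> complex) \<Rightarrow>
    ('v, 'w) tensor \<Rightarrow> ('v, 'w) tensor \<Rightarrow> ('v, 'w) tensor"
  where "gl_bracket p x y = gl_mult p x y - gl_mult p y x"

definition sl :: "('v::cvector \<Rightarrow> 'w::cvector \<Rightarrow> complex) \<Rightarrow> ('v, 'w) tensor set"
  where "sl p = derived_algebra (gl_bracket p) UNIV"

definition imm_pair :: "'a set set \<Rightarrow> 'a set \<Rightarrow> 'a set \<Rightarrow> bool"
  where "imm_pair C F' F'' \<longleftrightarrow>
    F' \<in> C \<and> F'' \<in> C \<and> F' \<subset> F'' \<and> \<not> (\<exists>G\<in>C. F' \<subset> G \<and> G \<subset> F'')"

definition generalized_flag :: "'a::cvector set set \<Rightarrow> bool"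
  where "generalized_flag C \<longleftrightarrow>
    (\<forall>F\<in>C. cvec.subspace F) \<and>
    (\<forall>F\<in>C. \<forall>G\<in>C. F \<subseteq> G \<or> G \<subseteq> F) \<and>
    (\<forall>F\<in>C. (\<exists>G. imm_pair C G F) \<or> (\<exists>G. imm_pair C F G)) \<and>
    (\<forall>x. x \<noteq> 0 \<longrightarrow> (\<exists>F' F''. imm_pair C F' F'' \<and> x \<in> F'' - F'))"

text \<open>In a chain the immediate pair around a given \<open>x\<close> is unique, so the quantification over pairs
  below ranges over exactly one pair in each flag.\<close>

definition refines :: "'a::cvector set set \<Rightarrow> 'a set set \<Rightarrow> bool"
  where "refines D C \<longleftrightarrow>
    (\<forall>x F' F'' G' G''. x \<noteq> 0 \<and> imm_pair C F' F'' \<and> x \<in> F'' - F' \<and>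
      imm_pair D G' G'' \<and> x \<in> G'' - G' \<longrightarrow> F' \<subseteq> G' \<and> G'' \<subseteq> F'')"

definition perp :: "('v \<Rightarrow> 'w \<Rightarrow> complex) \<Rightarrow> 'v set \<Rightarrow> 'w set"
  where "perp p F = {w. \<forall>v\<in>F. p v w = 0}"

definition pclosure :: "('v \<Rightarrow> 'w \<Rightarrow> complex) \<Rightarrow> 'v set \<Rightarrow> 'v set"
  where "pclosure p F = {v. \<forall>w\<in>perp p F. p v w = 0}"

definition closed_flag :: "('v::cvector \<Rightarrow> 'w::cvector \<Rightarrow> complex) \<Rightarrow> 'v set set \<Rightarrow> bool"
  where "closed_flag p C \<longleftrightarrow> generalized_flag C \<and>
    (\<forall>F' F''. imm_pair C F' F'' \<longrightarrow>
      pclosure p F'' = F'' \<and> (pclosure p F' = F' \<or> pclosure p F' = F''))"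

definition maximal_closed_flag :: "('v::cvector \<Rightarrow> 'w::cvector \<Rightarrow> complex) \<Rightarrow> 'v set set \<Rightarrow> bool"
  where "maximal_closed_flag p C \<longleftrightarrow> closed_flag p C \<and>
    (\<forall>D. closed_flag p D \<and> refines D C \<longrightarrow> D = C)"

definition stabilizer ::
    "('v::cvector \<Rightarrow> 'w::cvector \<Rightarrow> complex) \<Rightarrow> 'v set set \<Rightarrow> ('v, 'w) tensor set"
  where "stabilizer p C = {X \<in> sl p. \<forall>F\<in>C. gl_act p X ` F \<subseteq> F}"

end

theory Submission
  imports Defs "HOL-Computational_Algebra.Fundamental_Theorem_Algebra"
begin

text \<open>A finite-rank operator takes on the closure of a subspace only values it takes on the subspace
  itself, so an element of the stabilizer of a closed flag maps the upper member of a pair with dense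
  lower member into the lower one. If the good pairs are lines, commutators in the stabilizer
  therefore lower the flag, and every finitely generated part of the stabilizer is solvable.

  Conversely, for a locally solvable subalgebra \<open>B\<close> take a maximal chain of closed \<open>B\<close>-stable subspaces
  and the closed generalized flag it generates. Lie's theorem for finitely many elements of \<open>B\<close> and
  the continuity of finite-rank operators show that \<open>B\<close> acts by scalars on each good pair, so good
  pairs are lines and the flag is maximal.

  Finally, the stabilizer of a maximal closed flag contains enough operators \<open>v \<otimes> w\<close> to show that
  an inclusion of stabilizers implies a refinement of the flags, hence their equality.\<close>

section \<open>Eigenvectors modulo a subspace\<close>

lemma clinear_simps:
  assumes "clinear f"
  shows "f (x + y) = f x + f y" "f (c *\<^sub>C x) = c *\<^sub>C f x" "f 0 = 0"
    "f (x - y) = f x - f y"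
proof -
  interpret L: Vector_Spaces.linear cscale cscale f by (rule assms)
  show "f (x + y) = f x + f y" "f (c *\<^sub>C x) = c *\<^sub>C f x" "f 0 = 0" "f (x - y) = f x - f y"
    by (simp_all add: L.add L.scale L.diff)
qed

lemma clinear_subspace_vimage:
  assumes "clinear f" "cvec.subspace S"
  shows "cvec.subspace {x. f x \<in> S}"
  using assms(2) unfolding cvec.subspace_def by (simp add: clinear_simps[OF assms(1)])

lemma clinear_subspace_image:
  assumes "clinear f" "cvec.subspace S"
  shows "cvec.subspace (f ` S)"
proof -
  interpret L: Vector_Spaces.linear cscale cscale f by (rule assms)
  show ?thesis by (rule L.subspace_image[OF assms(2)])
qed

lemma clinear_span_image_subset:
  assumes "clinear f" "cvec.subspace T" "\<And>x. x \<in> S \<Longrightarrow> f x \<in> T" "y \<in> cvec.span S"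
  shows "f y \<in> T"
proof -
  have "cvec.span S \<subseteq> {x. f x \<in> T}"
    by (rule cvec.span_minimal) (use assms clinear_subspace_vimage in auto)
  then show ?thesis using assms(4) by auto
qed

lemma clinear_diff_scale:
  assumes "clinear f"
  shows "clinear (\<lambda>x. f x - c *\<^sub>C x)"
  unfolding clinear_iff
  by (simp add: clinear_simps[OF assms] cscale_add_right cvec.scale_right_diff_distrib mult.commute)

lemma subspace_minus_swap:
  assumes "cvec.subspace P" "x - y \<in> P"
  shows "x \<in> P \<longleftrightarrow> y \<in> P"
  using cvec.subspace_diff[OF assms(1) _ assms(2), of x] cvec.subspace_add[OF assms(1) assms(2), of y]
  by auto

lemma subspace_scale_cancel:
  assumes "cvec.subspace P" "c *\<^sub>C v \<in> P" "c \<noteq> 0"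
  shows "v \<in> P"
  using cvec.subspace_scale[OF assms(1,2), of "inverse c"] assms(3) by simp

lemma finite_dim_subset:
  assumes "finite_dim V0" "cvec.subspace U" "U \<subseteq> V0"
  shows "finite_dim U"
proof -
  obtain S where S: "finite S" "cvec.span S = V0" using assms(1) by (auto simp: finite_dim_def)
  obtain B where B: "B \<subseteq> U" "cvec.independent B" "U \<subseteq> cvec.span B" "card B = cvec.dim U"
    by (rule cvec.basis_exists)
  have "finite B" using cvec.independent_span_bound[OF S(1) B(2)] B(1) S(2) assms(3) by auto
  moreover have "cvec.span B = U" using B assms(2) by (metis cvec.span_subspace)
  ultimately show ?thesis by (auto simp: finite_dim_def)
qed

lemma finite_dim_subspace: "finite_dim V0 \<Longrightarrow> cvec.subspace V0"
  by (auto simp: finite_dim_def)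

lemma dim_strict_mono:
  assumes "finite_dim W" "cvec.subspace U" "U \<subset> W"
  shows "cvec.dim U < cvec.dim W"
proof -
  obtain S where S: "finite S" "cvec.span S = W" using assms(1) by (auto simp: finite_dim_def)
  obtain B where B: "B \<subseteq> U" "cvec.independent B" "U \<subseteq> cvec.span B" "card B = cvec.dim U"
    by (rule cvec.basis_exists)
  obtain C where C: "C \<subseteq> W" "cvec.independent C" "W \<subseteq> cvec.span C" "card C = cvec.dim W"
    by (rule cvec.basis_exists)
  have fC: "finite C" using cvec.independent_span_bound[OF S(1) C(2)] C(1) S(2) by auto
  obtain x where x: "x \<in> W" "x \<notin> U" using assms(3) by auto
  have spB: "cvec.span B = U" using B assms(2) by (metis cvec.span_subspace)
  have "cvec.independent (insert x B)" using B(2) x spB by (simp add: cvec.independent_insertI)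
  then have "finite (insert x B) \<and> card (insert x B) \<le> card C"
    by (rule cvec.independent_span_bound[OF fC]) (use B(1) assms(3) x(1) C(3) in auto)
  moreover have "card (insert x B) = Suc (card B)"
    using calculation x(2) B(1) by (intro card_insert_disjoint) auto
  ultimately show ?thesis using B(4) C(4) by simp
qed

lemma krylov:
  fixes v :: "nat \<Rightarrow> 'v::cvector"
  assumes "finite_dim V0" "range v \<subseteq> V0"
  shows "\<exists>n. v n \<in> cvec.span (P \<union> v ` {..<n})"
proof (rule ccontr)
  assume "\<nexists>n. v n \<in> cvec.span (P \<union> v ` {..<n})"
  then have n: "v n \<notin> cvec.span (v ` {..<n})" for n
    using cvec.span_mono[of "v ` {..<n}" "P \<union> v ` {..<n}"] by blast
  obtain S where S: "finite S" "cvec.span S = V0" using assms(1) by (auto simp: finite_dim_def)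
  have "cvec.independent (v ` {..<n}) \<and> card (v ` {..<n}) = n" for n
  proof (induction n)
    case (Suc k)
    have "v k \<notin> v ` {..<k}" using n[of k] by (meson cvec.span_base)
    then show ?case using Suc n[of k]
      by (simp add: lessThan_Suc cvec.independent_insertI)
  qed (simp add: cvec.independent_empty)
  from this[of "Suc (card S)"] show False
    using cvec.independent_span_bound[OF S(1), of "v ` {..<Suc (card S)}"] assms(2) S(2)
    by (metis (no_types, lifting) image_subset_iff not_less_eq_eq order_refl range_subsetD)
qed

definition poly_act :: "complex poly \<Rightarrow> ('v::cvector \<Rightarrow> 'v) \<Rightarrow> 'v \<Rightarrow> 'v"
  where "poly_act f X v = fold_coeffs (\<lambda>a u. a *\<^sub>C v + X u) f 0"

lemma poly_act_0 [simp]: "poly_act 0 X v = 0"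
  by (simp add: poly_act_def)

lemma poly_act_pCons:
  assumes "clinear X"
  shows "poly_act (pCons a f) X v = a *\<^sub>C v + X (poly_act f X v)"
  by (cases "a = 0 \<and> f = 0")
    (auto simp: poly_act_def fold_coeffs_pCons_coeff_not_0_eq fold_coeffs_pCons_not_0_0_eq
      clinear_simps[OF assms])

lemma poly_act_add:
  assumes "clinear X"
  shows "poly_act (f + g) X v = poly_act f X v + poly_act g X v"
  by (induction f g rule: poly_induct2)
    (simp_all add: poly_act_pCons[OF assms] clinear_simps[OF assms] cscale_add_left)

lemma poly_act_smult:
  assumes "clinear X"
  shows "poly_act (smult c f) X v = c *\<^sub>C poly_act f X v"
  by (induction f)
    (simp_all add: poly_act_pCons[OF assms] clinear_simps[OF assms] cscale_add_right cscale_cscale)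

lemma poly_act_linear_factor:
  assumes "clinear X"
  shows "poly_act ([:-\<alpha>, 1:] * g) X v = poly_act g X (X v - \<alpha> *\<^sub>C v)"
proof -
  have "poly_act g X (X v - \<alpha> *\<^sub>C v) = X (poly_act g X v) - \<alpha> *\<^sub>C poly_act g X v"
  proof (induction g)
    case (pCons a g)
    show ?case
      unfolding poly_act_pCons[OF assms] pCons.IH
      by (simp add: clinear_simps[OF assms] cscale_add_right cvec.scale_right_diff_distrib mult.commute)
  qed (simp add: clinear_simps[OF assms])
  moreover have "[:-\<alpha>, 1:] * g = pCons 0 g + smult (-\<alpha>) g" by simp
  ultimately show ?thesis
    by (simp only: poly_act_add[OF assms] poly_act_smult[OF assms] poly_act_pCons[OF assms]) simp
qed

lemma poly_act_monom:
  assumes "clinear X"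
  shows "poly_act (monom 1 n) X v = (X ^^ n) v"
  by (induction n) (simp_all add: poly_act_pCons[OF assms] clinear_simps[OF assms] monom_0 monom_Suc)

lemma eigenvector_mod:
  fixes X :: "'v::cvector \<Rightarrow> 'v"
  assumes X: "clinear X" "X ` V0 \<subseteq> V0" and V0: "finite_dim V0" "\<not> V0 \<subseteq> P" and P: "cvec.subspace P"
  shows "\<exists>q\<in>V0 - P. \<exists>a. X q - a *\<^sub>C q \<in> P"
proof -
  have sV: "cvec.subspace V0" using V0(1) by (rule finite_dim_subspace)
  define A where "A f \<longleftrightarrow> f \<noteq> 0 \<and> (\<exists>v\<in>V0 - P. poly_act f X v \<in> P)" for f
  obtain v where v: "v \<in> V0" "v \<notin> P" using V0(2) by auto
  have orbit: "(X ^^ k) v \<in> V0" for k using v X(2) by (induction k) auto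
  obtain n where n: "(X ^^ n) v \<in> cvec.span ((\<lambda>k. (X ^^ k) v) ` {..<n})"
    using krylov[OF V0(1), of "\<lambda>k. (X ^^ k) v" "{}"] orbit by auto
  have "\<exists>g. (g = 0 \<or> degree g < n) \<and> y = poly_act g X v"
    if "y \<in> cvec.span ((\<lambda>k. (X ^^ k) v) ` {..<n})" for y
    using that
  proof (induction rule: cvec.span_induct_alt)
    case base
    show ?case by (rule exI[of _ 0]) simp
  next
    case (step c x y)
    then obtain k g where k: "k < n" "x = (X ^^ k) v" and g: "g = 0 \<or> degree g < n" "y = poly_act g X v"
      by auto
    have "degree (smult c (monom 1 k) + g) < n"
      using k g degree_add_less[of "smult c (monom 1 k)" n g] degree_smult_le[of c "monom 1 k"]
        degree_monom_le[of "1::complex" k] by force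
    then show ?case using k g
      by (intro exI[of _ "smult c (monom 1 k) + g"])
        (simp add: poly_act_add[OF X(1)] poly_act_smult[OF X(1)] poly_act_monom[OF X(1)])
  qed
  from this[OF n] obtain g where g: "g = 0 \<or> degree g < n" "(X ^^ n) v = poly_act g X v" by auto
  have "coeff (monom 1 n + smult (-1) g) n = 1"
    using g(1) by (auto simp: coeff_eq_0)
  then have "monom 1 n + smult (-1) g \<noteq> 0" by force
  moreover have "poly_act (monom 1 n + smult (-1) g) X v = 0"
    using g(2) by (simp add: poly_act_add[OF X(1)] poly_act_smult[OF X(1)] poly_act_monom[OF X(1)]
        del: smult_minus_left)
  ultimately have "A (monom 1 n + smult (-1) g)"
    unfolding A_def using v cvec.subspace_0[OF P] by (metis DiffI)
  then obtain f where f: "A f" and min: "\<And>g. A g \<Longrightarrow> degree f \<le> degree g"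
    using ex_has_least_nat[of A _ degree] by blast
  from f obtain v where v: "v \<in> V0" "v \<notin> P" "poly_act f X v \<in> P" "f \<noteq> 0" by (auto simp: A_def)
  have "degree f \<noteq> 0"
  proof
    assume "degree f = 0"
    then obtain c where c: "f = [:c:]" by (rule degree_eq_zeroE)
    then have "c \<noteq> 0" "c *\<^sub>C v \<in> P" using v by (auto simp: poly_act_pCons[OF X(1)] clinear_simps[OF X(1)])
    then show False using subspace_scale_cancel[OF P] v by blast
  qed
  then obtain \<alpha> where "poly f \<alpha> = 0"
    using fundamental_theorem_of_algebra[of f] constant_degree[of f] by auto
  then obtain g where fg: "f = [:-\<alpha>, 1:] * g" by (auto simp: poly_eq_0_iff_dvd)
  have "X v - \<alpha> *\<^sub>C v \<in> P"
  proof (rule ccontr)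
    assume "X v - \<alpha> *\<^sub>C v \<notin> P"
    moreover have "X v - \<alpha> *\<^sub>C v \<in> V0" using v(1) X(2) sV by (auto intro: cvec.subspace_diff cvec.subspace_scale)
    moreover have "g \<noteq> 0" using fg v(4) by auto
    ultimately have "A g" using v(3) by (auto simp: A_def fg poly_act_linear_factor[OF X(1)] simp del: mult_pCons_left)
    moreover have "degree f = Suc (degree g)" using fg \<open>g \<noteq> 0\<close> by (simp add: degree_mult_eq del: mult_pCons_left)
    ultimately show False using min[of g] by simp
  qed
  then show ?thesis using v by auto
qed

text \<open>A trace-free version of the step in Lie's theorem showing that the weight vanishes on
  commutators: the trace of the commutator on the span of the \<open>v\<^sub>k\<close> is replaced by the coefficient
  \<open>k \<mu>\<close> of \<open>v\<^sub>k\<^sub>-\<^sub>1\<close> in \<open>X v\<^sub>k\<close>, compared at the first linear dependence.\<close>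

lemma commutator_weight_zero:
  fixes X Y :: "'v::cvector \<Rightarrow> 'v"
  assumes X: "clinear X" "X ` P \<subseteq> P" and Y: "clinear Y" "Y ` P \<subseteq> P" and P: "cvec.subspace P"
    and w: "w \<notin> P" "X w - \<kappa> *\<^sub>C w \<in> P" and V0: "finite_dim V0" "\<And>k. (Y ^^ k) w \<in> V0"
    and Z: "\<And>k. X (Y ((Y ^^ k) w)) - Y (X ((Y ^^ k) w)) - \<mu> *\<^sub>C (Y ^^ k) w
              \<in> cvec.span (P \<union> (\<lambda>k. (Y ^^ k) w) ` {..<k})"
  shows "\<mu> = 0"
proof -
  define v where "v k = (Y ^^ k) w" for k
  define U where "U k = cvec.span (P \<union> v ` {..<k})" for k
  define X' where "X' u = X u - \<kappa> *\<^sub>C u" for u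
  have linX': "clinear X'" unfolding X'_def by (rule clinear_diff_scale[OF X(1)])
  have v_Suc: "v (Suc k) = Y (v k)" for k by (simp add: v_def)
  have sU: "cvec.subspace (U k)" for k by (simp add: U_def)
  have Z: "X (Y (v k)) - Y (X (v k)) - \<mu> *\<^sub>C v k \<in> U k" for k
    using Z[of k] by (simp add: U_def v_def)
  have mono: "U i \<subseteq> U j" if "i \<le> j" for i j
    unfolding U_def by (rule cvec.span_mono) (use that in auto)
  have PU: "P \<subseteq> U k" for k unfolding U_def using cvec.span_superset by blast
  have vU: "v i \<in> U k" if "i < k" for i k unfolding U_def by (rule cvec.span_base) (use that in auto)
  have YU: "Y u \<in> U (Suc k)" if "u \<in> U k" for u k
    by (rule clinear_span_image_subset[OF Y(1) sU _ that[unfolded U_def]])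
      (use Y(2) PU in \<open>auto simp: v_Suc[symmetric] intro: vU\<close>)
  have step: "X' (v (Suc k)) - (of_nat (Suc k) * \<mu>) *\<^sub>C v k \<in> U k" for k
  proof (induction k)
    case 0
    have "Y (X w - \<kappa> *\<^sub>C w) \<in> U 0" using w(2) Y(2) PU by blast
    then have "(X (Y w) - Y (X w) - \<mu> *\<^sub>C w) + Y (X w - \<kappa> *\<^sub>C w) \<in> U 0"
      using Z[of 0] sU by (auto simp: v_def intro: cvec.subspace_add)
    then show ?case by (simp add: v_def X'_def clinear_simps[OF Y(1)] algebra_simps)
  next
    case (Suc k)
    have "(X (Y (v (Suc k))) - Y (X (v (Suc k))) - \<mu> *\<^sub>C v (Suc k))
        + Y (X' (v (Suc k)) - (of_nat (Suc k) * \<mu>) *\<^sub>C v k) \<in> U (Suc k)"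
      by (rule cvec.subspace_add[OF sU Z YU[OF Suc]])
    moreover have "of_nat (Suc (Suc k)) * \<mu> = \<mu> + of_nat (Suc k) * \<mu>"
      by (simp add: algebra_simps)
    ultimately show ?case
      by (simp only: X'_def clinear_simps[OF Y(1)] v_Suc cscale_add_left) (simp add: algebra_simps)
  qed
  have X'v: "X' (v k) \<in> U k" for k
  proof (cases k)
    case 0
    moreover have "v 0 = w" by (simp add: v_def)
    ultimately show ?thesis using w(2) PU[of 0] by (auto simp only: X'_def)
  next
    case (Suc j)
    have "(of_nat (Suc j) * \<mu>) *\<^sub>C v j \<in> U (Suc j)"
      using vU[of j "Suc j"] sU by (blast intro: cvec.subspace_scale)
    moreover have "X' (v (Suc j)) - (of_nat (Suc j) * \<mu>) *\<^sub>C v j \<in> U (Suc j)"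
      using step[of j] mono[of j "Suc j"] by auto
    ultimately show ?thesis
      unfolding Suc using subspace_minus_swap[OF sU] by metis
  qed
  have X'U: "X' u \<in> U k" if "u \<in> U (Suc k)" for u k
  proof (rule clinear_span_image_subset[OF linX' sU _ that[unfolded U_def]])
    fix x assume "x \<in> P \<union> v ` {..<Suc k}"
    then consider "x \<in> P" | i where "i \<le> k" "x = v i"
      by (auto simp: less_Suc_eq_le)
    then show "X' x \<in> U k"
    proof cases
      case 1
      then have "X' x \<in> P" unfolding X'_def using X(2) P
        by (simp add: image_subset_iff cvec.subspace_diff cvec.subspace_scale)
      then show ?thesis using PU[of k] by blast
    next
      case 2
      then show ?thesis using X'v[of i] mono[of i k] by auto
    qed
  qed
  have "\<exists>n. v n \<in> U n" unfolding U_def by (rule krylov[OF V0(1)]) (use V0(2) in \<open>auto simp: v_def\<close>)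
  then obtain n where n: "v n \<in> U n" "\<And>m. m < n \<Longrightarrow> v m \<notin> U m"
    using exists_least_iff[of "\<lambda>n. v n \<in> U n"] by auto
  have "U 0 = P" using P by (simp add: U_def)
  moreover have "v 0 = w" by (simp add: v_def)
  ultimately have "n \<noteq> 0" using n(1) w(1) by metis
  then obtain m where m: "n = Suc m" by (cases n) auto
  have "(of_nat n * \<mu>) *\<^sub>C v m \<in> U m"
    using subspace_minus_swap[OF sU step[of m]] X'U[of "v n" m] n(1) unfolding m by simp
  then have "of_nat n * \<mu> = 0" using subspace_scale_cancel[OF sU] n(2)[of m] m by blast
  then show "\<mu> = 0" using m by (metis mult_eq_0_iff of_nat_eq_0_iff nat.distinct(1))
qed

lemma commuting_eigenvector_mod:
  fixes H :: "('v::cvector \<Rightarrow> 'v) set"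
  assumes lin: "\<And>X. X \<in> H \<Longrightarrow> clinear X" and P: "cvec.subspace P" "\<And>X. X \<in> H \<Longrightarrow> X ` P \<subseteq> P"
    and W: "finite_dim W" "P \<subset> W" "\<And>X. X \<in> H \<Longrightarrow> X ` W \<subseteq> W"
    and comm: "\<And>X Y w. X \<in> H \<Longrightarrow> Y \<in> H \<Longrightarrow> w \<in> W \<Longrightarrow> X (Y w) - Y (X w) \<in> P"
  shows "\<exists>q\<in>W - P. \<forall>X\<in>H. \<exists>a. X q - a *\<^sub>C q \<in> P"
proof -
  define A where "A U \<longleftrightarrow> cvec.subspace U \<and> P \<subset> U \<and> U \<subseteq> W \<and> (\<forall>X\<in>H. X ` U \<subseteq> U)" for U
  have "A W" using W finite_dim_subspace by (auto simp: A_def)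
  then obtain U where U: "A U" and min: "\<And>U'. A U' \<Longrightarrow> cvec.dim U \<le> cvec.dim U'"
    using ex_has_least_nat[of A _ cvec.dim] by blast
  have fU: "finite_dim U" using U W(1) finite_dim_subset unfolding A_def by blast
  obtain q where q: "q \<in> U" "q \<notin> P" using U by (auto simp: A_def)
  have "\<exists>a. X q - a *\<^sub>C q \<in> P" if XH: "X \<in> H" for X
  proof -
    obtain r a where r: "r \<in> U" "r \<notin> P" "X r - a *\<^sub>C r \<in> P"
      using eigenvector_mod[of X U P] lin[OF XH] U fU P(1) XH unfolding A_def by blast
    define K where "K = {u \<in> U. X u - a *\<^sub>C u \<in> P}"
    have lX: "clinear (\<lambda>u. X u - a *\<^sub>C u)" by (rule clinear_diff_scale[OF lin[OF XH]])
    have "cvec.subspace (U \<inter> {u. X u - a *\<^sub>C u \<in> P})"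
      by (rule cvec.subspace_inter) (use U clinear_subspace_vimage[OF lX P(1)] in \<open>auto simp: A_def\<close>)
    then have "cvec.subspace K" by (simp add: K_def Int_def)
    moreover have "P \<subseteq> K"
      unfolding K_def using P XH U
      by (auto simp: A_def intro!: cvec.subspace_diff cvec.subspace_scale)
    moreover have "r \<in> K" using r by (simp add: K_def)
    moreover have "K \<subseteq> U" by (auto simp: K_def)
    moreover have "Y u \<in> K" if YH: "Y \<in> H" and u: "u \<in> K" for Y u
    proof -
      have "X (Y u) - Y (X u) \<in> P" using comm XH YH u U by (auto simp: K_def A_def)
      moreover have "Y (X u - a *\<^sub>C u) \<in> P" using u P(2)[OF YH] by (auto simp: K_def)
      ultimately have "(X (Y u) - Y (X u)) + Y (X u - a *\<^sub>C u) \<in> P" using P(1) by (blast intro: cvec.subspace_add)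
      then have "X (Y u) - a *\<^sub>C Y u \<in> P" by (simp add: clinear_simps[OF lin[OF YH]])
      moreover have "Y u \<in> U" using u YH U by (auto simp: K_def A_def image_subset_iff)
      ultimately show ?thesis by (simp add: K_def)
    qed
    ultimately have "A K" using r U by (auto simp: A_def)
    then have "\<not> K \<subset> U" using min[of K] dim_strict_mono[OF fU, of K] by (auto simp: A_def)
    then have "q \<in> K" using q \<open>K \<subseteq> U\<close> by auto
    then show ?thesis by (auto simp: K_def)
  qed
  moreover have "q \<in> W - P" using q U by (auto simp: A_def)
  ultimately show ?thesis by blast
qed

section \<open>Finite-rank operators and the pairing\<close>

lemma tensor_span_UNIV: "cvec.span {v \<otimes>\<^sub>t w | v w. True} = UNIV"
proof -
  have "abs_tensor f \<in> cvec.span {v \<otimes>\<^sub>t w | v w. True}" for f :: "'a \<times> 'b \<Rightarrow>\<^sub>0 complex"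
  proof (induction f rule: update_induct)
    case const
    show ?case by (simp add: cvec.span_zero flip: zero_tensor_def)
  next
    case (update f k c)
    obtain v w where k: "k = (v, w)" by (cases k)
    have "Poly_Mapping.update k c f = f + c *\<^sub>C Poly_Mapping.single (v, w) 1"
      using update(1) by (intro poly_mapping_eqI)
        (auto simp: k lookup_update lookup_add lookup_cscale lookup_single cscale_complex_def in_keys_iff when_def)
    then have "abs_tensor (Poly_Mapping.update k c f) = abs_tensor f + c *\<^sub>C (v \<otimes>\<^sub>t w)"
      by (simp add: plus_tensor.abs_eq cscale_tensor.abs_eq tens.abs_eq)
    moreover have "c *\<^sub>C (v \<otimes>\<^sub>t w) \<in> cvec.span {v \<otimes>\<^sub>t w | v w. True}"
      by (intro cvec.span_scale cvec.span_base) auto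
    ultimately show ?case using update(3) by (simp add: cvec.span_add)
  qed
  then show ?thesis using Quotient3_abs_rep[OF Quotient3_tensor] by (metis UNIV_eq_I)
qed

lemma tensor_induct [case_names tens zero add scale]:
  assumes "\<And>v w. P (v \<otimes>\<^sub>t w)" "P 0" "\<And>x y. P x \<Longrightarrow> P y \<Longrightarrow> P (x + y)" "\<And>c x. P x \<Longrightarrow> P (c *\<^sub>C x)"
  shows "P x"
proof -
  have "x \<in> cvec.span {v \<otimes>\<^sub>t w | v w. True}" unfolding tensor_span_UNIV ..
  then show ?thesis
    by (induction rule: cvec.span_induct) (use assms in \<open>auto simp: cvec.subspace_def\<close>)
qed

lemma tens_0 [simp]: "0 \<otimes>\<^sub>t w = 0" "v \<otimes>\<^sub>t 0 = 0"
  using tens_simps(2)[of 0 0 w] tens_simps(4)[of v 0 0] by simp_all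

lemma tens_sum: "(\<Sum>i\<in>I. f i) \<otimes>\<^sub>t w = (\<Sum>i\<in>I. f i \<otimes>\<^sub>t w)"
  by (induction I rule: infinite_finite_induct) (simp_all add: tens_simps)

lemma tensor_basis_expansion:
  fixes x :: "('v::cvector, 'w::cvector) tensor"
  obtains S f where "finite S" "cvec.independent S" "x = (\<Sum>b\<in>S. b \<otimes>\<^sub>t f b)"
proof -
  obtain B :: "'v set" where B: "cvec.independent B" "cvec.span B = UNIV"
    using cvec.basis_exists[of UNIV] by (metis top.extremum_uniqueI)
  have "\<exists>S f. finite S \<and> S \<subseteq> B \<and> (\<forall>b. b \<notin> S \<longrightarrow> f b = 0) \<and> x = (\<Sum>b\<in>S. b \<otimes>\<^sub>t f b)"
  proof (induction x rule: tensor_induct)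
    case (tens v w)
    have "v \<in> cvec.span B" by (simp add: B)
    then obtain S r where S: "finite S" "S \<subseteq> B" "v = (\<Sum>b\<in>S. r b *\<^sub>C b)"
      unfolding cvec.span_explicit by auto
    then have "v \<otimes>\<^sub>t w = (\<Sum>b\<in>S. b \<otimes>\<^sub>t (if b \<in> S then r b *\<^sub>C w else 0))"
      by (auto simp: tens_sum tens_simps intro!: sum.cong)
    then show ?case using S(1,2) by (intro exI[of _ S] exI[of _ "\<lambda>b. if b \<in> S then r b *\<^sub>C w else 0"]) auto
  next
    case zero
    show ?case by (intro exI[of _ "{}"] exI[of _ "\<lambda>_. 0"]) auto
  next
    case (add x y)
    then obtain S f T g where f: "finite S" "S \<subseteq> B" "\<forall>b. b \<notin> S \<longrightarrow> f b = 0" "x = (\<Sum>b\<in>S. b \<otimes>\<^sub>t f b)"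
      and g: "finite T" "T \<subseteq> B" "\<forall>b. b \<notin> T \<longrightarrow> g b = 0" "y = (\<Sum>b\<in>T. b \<otimes>\<^sub>t g b)" by blast
    have "x = (\<Sum>b\<in>S \<union> T. b \<otimes>\<^sub>t f b)"
      unfolding f(4) by (rule sum.mono_neutral_left) (use f g in auto)
    moreover have "y = (\<Sum>b\<in>S \<union> T. b \<otimes>\<^sub>t g b)"
      unfolding g(4) by (rule sum.mono_neutral_left) (use f g in auto)
    ultimately have "x + y = (\<Sum>b\<in>S \<union> T. b \<otimes>\<^sub>t (f b + g b))" by (simp add: tens_simps sum.distrib)
    then show ?case using f g by (intro exI[of _ "S \<union> T"] exI[of _ "\<lambda>b. f b + g b"]) auto
  next
    case (scale c x)
    then obtain S f where f: "finite S" "S \<subseteq> B" "\<forall>b. b \<notin> S \<longrightarrow> f b = 0" "x = (\<Sum>b\<in>S. b \<otimes>\<^sub>t f b)" by blast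
    have "c *\<^sub>C x = (\<Sum>b\<in>S. b \<otimes>\<^sub>t (c *\<^sub>C f b))" by (simp add: f(4) cvec.scale_sum_right tens_simps)
    then show ?case using f by (intro exI[of _ S] exI[of _ "\<lambda>b. c *\<^sub>C f b"]) auto
  qed
  then show thesis using that B(1) cvec.independent_mono by blast
qed

lemma tensor_in_finite_product:
  assumes "finite (S :: ('v::cvector, 'w::cvector) tensor set)"
  shows "\<exists>A B. finite A \<and> finite B \<and> S \<subseteq> cvec.span {a \<otimes>\<^sub>t b | a b. a \<in> A \<and> b \<in> B}"
  using assms
proof (induction S rule: finite_induct)
  case (insert x S)
  then obtain A B where AB: "finite A" "finite B" "S \<subseteq> cvec.span {a \<otimes>\<^sub>t b | a b. a \<in> A \<and> b \<in> B}"
    by blast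
  obtain T f where T: "finite T" "x = (\<Sum>b\<in>T. b \<otimes>\<^sub>t f b)" by (rule tensor_basis_expansion)
  have "x \<in> cvec.span {a \<otimes>\<^sub>t b | a b. a \<in> A \<union> T \<and> b \<in> B \<union> f ` T}"
    unfolding T(2) by (intro cvec.span_sum cvec.span_base) auto
  moreover have "S \<subseteq> cvec.span {a \<otimes>\<^sub>t b | a b. a \<in> A \<union> T \<and> b \<in> B \<union> f ` T}"
    using AB(3) by (rule order_trans) (intro cvec.span_mono, auto)
  ultimately show ?case using AB T by (intro exI[of _ "A \<union> T"] exI[of _ "B \<union> f ` T"]) auto
qed auto

locale pairing =
  fixes p :: "'v::cvector \<Rightarrow> 'w::cvector \<Rightarrow> complex"
  assumes nondegenerate: "nondegenerate_pairing p"
begin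

lemma bilinear: "cbilinear p"
  using nondegenerate by (simp add: nondegenerate_pairing_def)

lemma pair_simps:
  "p (v + v') w = p v w + p v' w" "p (c *\<^sub>C v) w = c * p v w"
  "p v (w + w') = p v w + p v w'" "p v (c *\<^sub>C w) = c * p v w"
  using bilinear unfolding cbilinear_iff cscale_complex_def by blast+

lemma pair_0 [simp]: "p 0 w = 0" "p v 0 = 0"
  using pair_simps(2)[of 0 0 w] pair_simps(4)[of v 0 0] by simp_all

lemma pair_diff: "p (v - v') w = p v w - p v' w" "p v (w - w') = p v w - p v w'"
  using pair_simps(1)[of "v - v'" v' w] pair_simps(3)[of v "w - w'" w']
  by (simp_all add: eq_diff_eq)

lemma pair_nondegenerate: "(\<And>w. p v w = 0) \<Longrightarrow> v = 0" "(\<And>v. p v w = 0) \<Longrightarrow> w = 0"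
  using nondegenerate unfolding nondegenerate_pairing_def by blast+

abbreviation act :: "('v, 'w) tensor \<Rightarrow> 'v \<Rightarrow> 'v" where "act \<equiv> gl_act p"
abbreviation br :: "('v, 'w) tensor \<Rightarrow> ('v, 'w) tensor \<Rightarrow> ('v, 'w) tensor" where "br \<equiv> gl_bracket p"

lemma act_tens: "act (v \<otimes>\<^sub>t w) u = p u w *\<^sub>C v"
  by (rule gl_act_tens[OF bilinear])

lemma act_left:
  "act (X + Y) u = act X u + act Y u" "act (c *\<^sub>C X) u = c *\<^sub>C act X u" "act 0 u = 0"
  "act (X - Y) u = act X u - act Y u"
  using clinear_simps[OF clinear_gl_act[OF bilinear, of u]] by simp_all

lemma act_left_sum: "act (\<Sum>i\<in>I. f i) u = (\<Sum>i\<in>I. act (f i) u)"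
  by (induction I rule: infinite_finite_induct) (simp_all add: act_left)

lemma clinear_act: "clinear (act X)"
  unfolding clinear_iff gl_act_def
  by (simp add: pair_simps cscale_add_left tensor_lift_add_fun flip: tensor_lift_scale_fun cscale_cscale)

lemmas act_right = clinear_simps[OF clinear_act]

lemma mult_simps:
  "gl_mult p (X + Y) Z = gl_mult p X Z + gl_mult p Y Z" "gl_mult p (c *\<^sub>C X) Z = c *\<^sub>C gl_mult p X Z"
  "gl_mult p Z (X + Y) = gl_mult p Z X + gl_mult p Z Y" "gl_mult p Z (c *\<^sub>C X) = c *\<^sub>C gl_mult p Z X"
  "gl_mult p 0 Z = 0" "gl_mult p Z 0 = 0"
proof -
  have l: "clinear (\<lambda>X. gl_mult p X Z)" and r: "clinear (gl_mult p Z)"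
    using cbilinear_gl_mult[OF bilinear] by (auto simp: cbilinear_def)
  show "gl_mult p (X + Y) Z = gl_mult p X Z + gl_mult p Y Z" "gl_mult p (c *\<^sub>C X) Z = c *\<^sub>C gl_mult p X Z"
    "gl_mult p Z (X + Y) = gl_mult p Z X + gl_mult p Z Y" "gl_mult p Z (c *\<^sub>C X) = c *\<^sub>C gl_mult p Z X"
    "gl_mult p 0 Z = 0" "gl_mult p Z 0 = 0"
    using clinear_simps[OF l] clinear_simps[OF r] by simp_all
qed

lemma act_mult: "act (gl_mult p X Y) u = act X (act Y u)"
proof (induction X rule: tensor_induct)
  case (tens v w)
  show ?case
    by (induction Y rule: tensor_induct)
      (simp_all add: gl_mult_tens[OF bilinear] act_tens act_left mult_simps pair_simps cscale_add_left
        act_right cscale_add_right mult.commute)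
qed (simp_all add: mult_simps act_left)

lemma act_br: "act (br X Y) u = act X (act Y u) - act Y (act X u)"
  by (simp add: gl_bracket_def act_left act_mult)

lemma act_faithful:
  assumes "\<And>u. act X u = 0"
  shows "X = 0"
proof -
  obtain S f where S: "finite S" "cvec.independent S" "X = (\<Sum>b\<in>S. b \<otimes>\<^sub>t f b)"
    by (rule tensor_basis_expansion)
  have "f b = 0" if "b \<in> S" for b
  proof (rule pair_nondegenerate(2))
    fix u
    have "(\<Sum>b\<in>S. p u (f b) *\<^sub>C b) = 0" using assms[of u] by (simp add: S(3) act_left_sum act_tens)
    then show "p u (f b) = 0" by (rule cvec.independentD[OF S(2,1) order_refl _ that])
  qed
  then show ?thesis by (simp add: S(3))
qed

lemma act_adjoint: "\<exists>w'. \<forall>v. p (act X v) w = p v w'"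
proof (induction X rule: tensor_induct)
  case (tens a b)
  show ?case by (rule exI[of _ "p a w *\<^sub>C b"]) (simp add: act_tens pair_simps)
next
  case zero
  show ?case by (rule exI[of _ 0]) (simp add: act_left)
next
  case (add X Y)
  then obtain w1 w2 where "\<forall>v. p (act X v) w = p v w1" "\<forall>v. p (act Y v) w = p v w2" by blast
  then show ?case by (intro exI[of _ "w1 + w2"]) (simp add: act_left pair_simps)
next
  case (scale c X)
  then obtain w1 where "\<forall>v. p (act X v) w = p v w1" by blast
  then show ?case by (intro exI[of _ "c *\<^sub>C w1"]) (simp add: act_left pair_simps)
qed

lemma finite_dim_range_act: "finite_dim (range (act X))"
proof -
  obtain S f where S: "finite S" "X = (\<Sum>b\<in>S. b \<otimes>\<^sub>t f b)" by (rule tensor_basis_expansion)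
  have "range (act X) \<subseteq> cvec.span S"
    unfolding S(2) act_left_sum act_tens
    by (intro image_subsetI cvec.span_sum cvec.span_scale cvec.span_base)
  moreover have "cvec.subspace (range (act X))" by (rule clinear_subspace_image[OF clinear_act]) simp
  moreover have "finite_dim (cvec.span S)" using S(1) by (auto simp: finite_dim_def)
  ultimately show ?thesis using finite_dim_subset by blast
qed

definition stable :: "('v, 'w) tensor set \<Rightarrow> 'v set \<Rightarrow> bool"
  where "stable B F \<longleftrightarrow> (\<forall>X\<in>B. \<forall>v\<in>F. act X v \<in> F)"

lemma stableD: "stable B F \<Longrightarrow> X \<in> B \<Longrightarrow> v \<in> F \<Longrightarrow> act X v \<in> F"
  by (auto simp: stable_def)

lemma stable_mono: "stable B F \<Longrightarrow> A \<subseteq> B \<Longrightarrow> stable A F"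
  by (auto simp: stable_def)

lemma subspace_perp: "cvec.subspace (perp p F)"
  by (auto simp: cvec.subspace_def perp_def pair_simps)

lemma subspace_pclosure: "cvec.subspace (pclosure p F)"
  by (auto simp: cvec.subspace_def pclosure_def pair_simps)

lemma pclosure_superset: "F \<subseteq> pclosure p F"
  by (auto simp: pclosure_def perp_def)

lemma pclosure_mono: "F \<subseteq> G \<Longrightarrow> pclosure p F \<subseteq> pclosure p G"
  by (auto simp: pclosure_def perp_def)

lemma perp_pclosure: "perp p (pclosure p F) = perp p F"
  by (auto simp: pclosure_def perp_def)

lemma pclosure_idem: "pclosure p (pclosure p F) = pclosure p F"
  by (simp add: pclosure_def[of p "pclosure p F"] perp_pclosure) (simp add: pclosure_def)

lemma pclosure_minimal: "F \<subseteq> G \<Longrightarrow> pclosure p G = G \<Longrightarrow> pclosure p F \<subseteq> G"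
  using pclosure_mono by blast

lemma pclosure_Inter:
  assumes "\<And>C. C \<in> \<C> \<Longrightarrow> pclosure p C = C"
  shows "pclosure p (\<Inter>\<C>) = \<Inter>\<C>"
proof
  show "pclosure p (\<Inter>\<C>) \<subseteq> \<Inter>\<C>"
    using assms pclosure_mono[of "\<Inter>\<C>"] by blast
qed (rule pclosure_superset)

lemma pclosure_0: "pclosure p {0} = {0}"
  by (auto simp: pclosure_def perp_def intro!: pair_nondegenerate(1))

lemma pclosure_UNIV: "pclosure p UNIV = UNIV"
  using pclosure_superset[of UNIV] by auto

lemma not_in_closed:
  assumes "pclosure p F = F" "x \<notin> F"
  obtains w where "w \<in> perp p F" "p x w = 1"
proof -
  obtain w where w: "w \<in> perp p F" "p x w \<noteq> 0" using assms by (auto simp: pclosure_def)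
  have "inverse (p x w) *\<^sub>C w \<in> perp p F" using w(1) subspace_perp by (blast intro: cvec.subspace_scale)
  then show thesis using that w(2) by (auto simp: pair_simps)
qed

lemma closed_add_line:
  assumes "cvec.subspace F" "pclosure p F = F"
  shows "pclosure p (cvec.span (insert x F)) = cvec.span (insert x F)"
proof (cases "x \<in> F")
  case True
  then show ?thesis using assms by (metis insert_absorb cvec.span_eq_iff)
next
  case False
  then obtain w where w: "w \<in> perp p F" "p x w = 1" using not_in_closed assms(2) by blast
  have "y - p y w *\<^sub>C x \<in> F" if y: "y \<in> pclosure p (cvec.span (insert x F))" for y
  proof -
    have "p (y - p y w *\<^sub>C x) w' = 0" if w': "w' \<in> perp p F" for w'
    proof -
      define z where "z = w' - p x w' *\<^sub>C w"
      have "cvec.span (insert x F) \<subseteq> {v. p v z = 0}"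
        by (rule cvec.span_minimal)
          (use w w' in \<open>auto simp: z_def pair_simps pair_diff perp_def cvec.subspace_def distrib_left\<close>)
      then have "p y z = 0" using y by (auto simp: pclosure_def perp_def)
      then show ?thesis by (simp add: z_def pair_simps pair_diff mult.commute)
    qed
    then have "y - p y w *\<^sub>C x \<in> pclosure p F" by (simp add: pclosure_def)
    then show ?thesis using assms(2) by simp
  qed
  then have "y \<in> cvec.span (insert x F)" if "y \<in> pclosure p (cvec.span (insert x F))" for y
    using that cvec.span_base unfolding cvec.span_breakdown_eq by blast
  then show ?thesis using pclosure_superset by blast
qed

lemma stable_pclosure:
  assumes "stable B F"
  shows "stable B (pclosure p F)"
  unfolding stable_def
proof (intro ballI)
  fix X v assume X: "X \<in> B" and v: "v \<in> pclosure p F"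
  show "act X v \<in> pclosure p F"
    unfolding pclosure_def
  proof (clarsimp)
    fix w assume w: "w \<in> perp p F"
    obtain w' where w': "\<forall>v. p (act X v) w = p v w'" using act_adjoint by blast
    have "p v w' = 0" if "v \<in> F" for v
      using stableD[OF assms X that] w w'[rule_format, of v] by (simp add: perp_def)
    then have "w' \<in> perp p F" by (simp add: perp_def)
    then show "p (act X v) w = 0" using v w' by (auto simp: pclosure_def)
  qed
qed

lemma closed_eigenspace:
  assumes "pclosure p F = F"
  shows "pclosure p {v. act X v - a *\<^sub>C v \<in> F} = {v. act X v - a *\<^sub>C v \<in> F}" (is "pclosure p ?K = ?K")
proof -
  have "act X v - a *\<^sub>C v \<in> pclosure p F" if v: "v \<in> pclosure p ?K" for v
    unfolding pclosure_def
  proof clarsimp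
    fix w assume w: "w \<in> perp p F"
    obtain w' where w': "\<forall>v. p (act X v) w = p v w'" using act_adjoint by blast
    have eq: "p (act X u - a *\<^sub>C u) w = p u (w' - a *\<^sub>C w)" for u
      using w' by (simp add: pair_simps pair_diff)
    have "w' - a *\<^sub>C w \<in> perp p ?K" using w eq by (auto simp: perp_def)
    then show "p (act X v - a *\<^sub>C v) w = 0" using v eq by (auto simp: pclosure_def)
  qed
  then show ?thesis using assms pclosure_superset[of ?K] by auto
qed

lemma functional_in_span:
  assumes "finite S" "cvec.subspace F" "\<And>v. v \<in> F \<Longrightarrow> (\<forall>s\<in>S. p v s = 0) \<Longrightarrow> p v w = 0"
  shows "\<exists>w'\<in>cvec.span S. \<forall>v\<in>F. p v w = p v w'"
  using assms
proof (induction S arbitrary: F w rule: finite_induct)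
  case empty
  then show ?case by auto
next
  case (insert s S)
  have sub: "cvec.subspace (F \<inter> {v. p v s = 0})"
    by (rule cvec.subspace_inter[OF insert.prems(1)]) (auto simp: cvec.subspace_def pair_simps)
  have "\<exists>w'\<in>cvec.span S. \<forall>v\<in>F \<inter> {v. p v s = 0}. p v w = p v w'"
    by (rule insert.IH[OF sub]) (use insert.prems(2) in auto)
  then obtain w' where w': "w' \<in> cvec.span S" "\<And>v. v \<in> F \<Longrightarrow> p v s = 0 \<Longrightarrow> p v w = p v w'" by auto
  show ?case
  proof (cases "\<forall>v\<in>F. p v s = 0")
    case True
    then show ?thesis using w' cvec.span_mono[of S "insert s S"] by blast
  next
    case False
    then obtain t where t: "t \<in> F" "p t s \<noteq> 0" by auto
    define c where "c = (p t w - p t w') / p t s"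
    have "p v w = p v (w' + c *\<^sub>C s)" if v: "v \<in> F" for v
    proof -
      have "v - (p v s / p t s) *\<^sub>C t \<in> F"
        using v t insert.prems(1) by (blast intro: cvec.subspace_diff cvec.subspace_scale)
      from w'(2)[OF this] show ?thesis
        using t(2) by (simp add: pair_simps pair_diff c_def field_simps)
    qed
    moreover have "w' + c *\<^sub>C s \<in> cvec.span (insert s S)"
      using w'(1) cvec.span_mono[of S "insert s S"] by (blast intro: cvec.span_add cvec.span_scale cvec.span_base)
    ultimately show ?thesis by blast
  qed
qed

lemma pclosure_finite_agreement:
  assumes "finite S" "cvec.subspace F" "u \<in> pclosure p F"
  shows "\<exists>u'\<in>F. \<forall>s\<in>S. p u s = p u' s"
  using assms(1)
proof (induction S rule: finite_induct)
  case empty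
  then show ?case using cvec.subspace_0[OF assms(2)] by auto
next
  case (insert s S)
  then obtain u' where u': "u' \<in> F" "\<forall>s\<in>S. p u s = p u' s" by blast
  show ?case
  proof (cases "\<exists>t\<in>F. (\<forall>s\<in>S. p t s = 0) \<and> p t s \<noteq> 0")
    case True
    then obtain t where t: "t \<in> F" "\<forall>s\<in>S. p t s = 0" "p t s \<noteq> 0" by blast
    define c where "c = (p u s - p u' s) / p t s"
    have "u' + c *\<^sub>C t \<in> F" using u' t assms(2) by (blast intro: cvec.subspace_add cvec.subspace_scale)
    moreover have "\<forall>r\<in>insert s S. p u r = p (u' + c *\<^sub>C t) r"
      using u' t by (auto simp: pair_simps c_def)
    ultimately show ?thesis by blast
  next
    case False
    then obtain w where w: "w \<in> cvec.span S" "\<forall>v\<in>F. p v s = p v w"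
      using functional_in_span[OF insert.hyps(1) assms(2), of s] by blast
    then have "s - w \<in> perp p F" by (simp add: perp_def pair_diff)
    then have us: "p u s = p u w" using assms(3) by (auto simp: pclosure_def pair_diff)
    have "cvec.span S \<subseteq> {w. p u w = p u' w}"
      by (rule cvec.span_minimal) (use u' in \<open>auto simp: cvec.subspace_def pair_simps\<close>)
    then have "p u s = p u' s" using us w u'(1) by auto
    then show ?thesis using u' by blast
  qed
qed

lemma act_pclosure:
  assumes "cvec.subspace F" "u \<in> pclosure p F"
  shows "\<exists>u'\<in>F. act X u' = act X u"
proof -
  obtain S f where S: "finite S" "X = (\<Sum>b\<in>S. b \<otimes>\<^sub>t f b)" by (rule tensor_basis_expansion)
  obtain u' where "u' \<in> F" "\<forall>s\<in>f ` S. p u s = p u' s"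
    using pclosure_finite_agreement[OF _ assms, of "f ` S"] S(1) by auto
  then show ?thesis by (intro bexI[of _ u']) (simp_all add: S(2) act_left_sum act_tens)
qed

end

section \<open>Lie's theorem and topologically irreducible pairs\<close>

lemma derived_algebra_mono: "A \<subseteq> B \<Longrightarrow> derived_algebra br A \<subseteq> derived_algebra br B"
  unfolding derived_algebra_def by (intro cvec.span_mono) auto

lemma derived_series_mono:
  "A \<subseteq> B \<Longrightarrow> (derived_algebra br ^^ n) A \<subseteq> (derived_algebra br ^^ n) B"
  by (induction n) (auto intro: derived_algebra_mono[THEN subsetD])

lemma derived_algebra_subset: "lie_subalgebra br H \<Longrightarrow> derived_algebra br H \<subseteq> H"
  unfolding derived_algebra_def lie_subalgebra_def by (intro cvec.span_minimal) auto

lemma lie_subalgebra_derived: "lie_subalgebra br H \<Longrightarrow> lie_subalgebra br (derived_algebra br H)"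
  using derived_algebra_subset[of br H] unfolding lie_subalgebra_def
  by (auto simp: derived_algebra_def intro!: cvec.span_base)

context pairing
begin

lemma lie_theorem_mod:
  assumes "lie_subalgebra br H" "(derived_algebra br ^^ n) H \<subseteq> {0}"
    and V0: "finite_dim V0" "stable H V0" and P: "cvec.subspace P" "P \<subset> V0" "stable H P"
  shows "\<exists>q\<in>V0 - P. \<forall>X\<in>H. \<exists>a. act X q - a *\<^sub>C q \<in> P"
  using assms(1,2) V0(2) P(3)
proof (induction n arbitrary: H)
  case 0
  obtain q where "q \<in> V0 - P" using P(2) by blast
  moreover have "\<forall>X\<in>H. \<exists>a. act X q - a *\<^sub>C q \<in> P"
  proof
    fix X assume "X \<in> H"
    then have "act X q - 0 *\<^sub>C q \<in> P" using 0(2) cvec.subspace_0[OF P(1)] by (auto simp: act_left)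
    then show "\<exists>a. act X q - a *\<^sub>C q \<in> P" ..
  qed
  ultimately show ?case by blast
next
  case (Suc n)
  define K where "K = derived_algebra br H"
  have KH: "K \<subseteq> H" unfolding K_def by (rule derived_algebra_subset[OF Suc.prems(1)])
  have brK: "br X Y \<in> K" if "X \<in> H" "Y \<in> H" for X Y
    unfolding K_def derived_algebra_def using that by (intro cvec.span_base) auto
  have sP: "cvec.subspace P" and sV: "cvec.subspace V0" using P(1) V0(1) finite_dim_subspace by auto
  have "\<exists>q\<in>V0 - P. \<forall>X\<in>K. \<exists>a. act X q - a *\<^sub>C q \<in> P"
  proof (rule Suc.IH)
    show "lie_subalgebra br K" unfolding K_def by (rule lie_subalgebra_derived[OF Suc.prems(1)])
    show "(derived_algebra br ^^ n) K \<subseteq> {0}" using Suc.prems(2) by (simp add: K_def funpow_swap1)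
    show "stable K V0" "stable K P" using Suc.prems(3,4) KH stable_mono by blast+
  qed
  then obtain q l where q: "q \<in> V0" "q \<notin> P" "\<And>X. X \<in> K \<Longrightarrow> act X q - l X *\<^sub>C q \<in> P"
    by (metis DiffE)
  define W where "W = V0 \<inter> (\<Inter>X\<in>K. {v. act X v - l X *\<^sub>C v \<in> P})"
  have WD: "v \<in> V0" "X \<in> K \<Longrightarrow> act X v - l X *\<^sub>C v \<in> P" if "v \<in> W" for v X
    using that by (auto simp: W_def)
  have WI: "v \<in> W" if "v \<in> V0" "\<And>X. X \<in> K \<Longrightarrow> act X v - l X *\<^sub>C v \<in> P" for v
    using that by (auto simp: W_def)
  have sW: "cvec.subspace W"
    unfolding W_def
    by (intro cvec.subspace_inter sV cvec.subspace_Int clinear_subspace_vimage clinear_diff_scale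
        clinear_act sP)
  have fW: "finite_dim W" by (rule finite_dim_subset[OF V0(1) sW]) (auto simp: W_def)
  have PW: "P \<subseteq> W"
  proof
    fix v assume v: "v \<in> P"
    show "v \<in> W"
    proof (rule WI)
      show "v \<in> V0" using v P(2) by blast
      fix X assume "X \<in> K"
      then show "act X v - l X *\<^sub>C v \<in> P"
        using v stableD[OF Suc.prems(4)] KH sP by (meson cvec.subspace_diff cvec.subspace_scale subsetD)
    qed
  qed
  have qW: "q \<in> W" using q by (auto intro: WI)
  have actP: "act X ` P \<subseteq> P" if "X \<in> H" for X using that stableD[OF Suc.prems(4)] by blast
  have orbit: "(act Y ^^ k) v \<in> V0" if "Y \<in> H" "v \<in> V0" for Y v k
    using that stableD[OF Suc.prems(3)] by (induction k) auto
  have weight: "l (br X Y) = 0" if v: "v \<in> W" "v \<notin> P" and X: "X \<in> K" and Y: "Y \<in> H" for v X Y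
  proof (rule commutator_weight_zero[OF clinear_act actP clinear_act actP sP v(2)])
    let ?U = "\<lambda>k. cvec.span (P \<union> (\<lambda>k. (act Y ^^ k) v) ` {..<k})"
    show "X \<in> H" "Y \<in> H" using X Y KH by auto
    show "act X v - l X *\<^sub>C v \<in> P" using WD v X by blast
    show "finite_dim V0" by (rule V0(1))
    show "(act Y ^^ k) v \<in> V0" for k using orbit Y WD(1)[OF v(1)] by blast
    have U_mono: "?U k \<subseteq> ?U (Suc k)" for k by (rule cvec.span_mono) auto
    have v_in: "(act Y ^^ k) v \<in> ?U (Suc k)" for k by (rule cvec.span_base) auto
    have YU: "act Y u \<in> ?U (Suc k)" if "u \<in> ?U k" for u k
    proof (rule clinear_span_image_subset[OF clinear_act _ _ that])
      fix x assume "x \<in> P \<union> (\<lambda>k. (act Y ^^ k) v) ` {..<k}"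
      then consider "x \<in> P" | i where "i < k" "x = (act Y ^^ i) v" by auto
      then show "act Y x \<in> ?U (Suc k)"
      proof cases
        case 1
        then show ?thesis using actP[OF Y] by (intro cvec.span_base) auto
      next
        case 2
        then have "act Y x = (act Y ^^ Suc i) v" "Suc i < Suc k" by auto
        then show ?thesis by (intro cvec.span_base) (metis UnI2 image_eqI lessThan_iff)
      qed
    qed simp
    have tri: "\<forall>X'\<in>K. act X' ((act Y ^^ k) v) - l X' *\<^sub>C (act Y ^^ k) v \<in> ?U k" for k
    proof (induction k)
      case 0
      show ?case using WD(2)[OF v(1)] by (auto intro!: cvec.span_base)
    next
      case (Suc k)
      show ?case
      proof
        fix X' assume X': "X' \<in> K"
        let ?v = "(act Y ^^ k) v"
        have b: "br X' Y \<in> K" using brK X' Y KH by blast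
        have "act Y (act X' ?v - l X' *\<^sub>C ?v) \<in> ?U (Suc k)" using YU Suc X' by blast
        moreover have "act (br X' Y) ?v - l (br X' Y) *\<^sub>C ?v \<in> ?U (Suc k)"
          using Suc b U_mono[of k] by blast
        moreover have "l (br X' Y) *\<^sub>C ?v \<in> ?U (Suc k)" using v_in by (rule cvec.span_scale)
        ultimately have "act Y (act X' ?v - l X' *\<^sub>C ?v)
            + ((act (br X' Y) ?v - l (br X' Y) *\<^sub>C ?v) + l (br X' Y) *\<^sub>C ?v) \<in> ?U (Suc k)"
          by (intro cvec.span_add)
        then show "act X' ((act Y ^^ Suc k) v) - l X' *\<^sub>C (act Y ^^ Suc k) v \<in> ?U (Suc k)"
          by (simp add: act_right act_br)
      qed
    qed
    show "act X (act Y ((act Y ^^ k) v)) - act Y (act X ((act Y ^^ k) v)) - l (br X Y) *\<^sub>C (act Y ^^ k) v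
        \<in> ?U k" for k
      using tri[of k, rule_format, OF brK[OF subsetD[OF KH X] Y]] by (simp add: act_br)
  qed
  have stW: "act Y v \<in> W" if v: "v \<in> W" and Y: "Y \<in> H" for v Y
  proof (cases "v \<in> P")
    case True
    then show ?thesis using PW actP[OF Y] by blast
  next
    case False
    show ?thesis
    proof (rule WI)
      show "act Y v \<in> V0" using stableD[OF Suc.prems(3) Y] WD(1)[OF v] by blast
      fix X assume X: "X \<in> K"
      have b: "br X Y \<in> K" using brK X Y KH by blast
      have "act (br X Y) v \<in> P" using WD(2)[OF v b] weight[OF v False X Y] by simp
      moreover have "act Y (act X v - l X *\<^sub>C v) \<in> P" using WD(2)[OF v X] actP[OF Y] by blast
      ultimately have "act (br X Y) v + act Y (act X v - l X *\<^sub>C v) \<in> P"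
        using sP by (rule cvec.subspace_add[rotated])
      then show "act X (act Y v) - l X *\<^sub>C act Y v \<in> P" by (simp add: act_right act_br)
    qed
  qed
  have comm: "act (br X Y) v \<in> P" if X: "X \<in> H" and Y: "Y \<in> H" and v: "v \<in> W" for X Y v
  proof -
    have "act X ` W \<subseteq> W" using stW X by blast
    moreover have "\<not> W \<subseteq> P" using qW q by blast
    ultimately obtain r a where r: "r \<in> W" "r \<notin> P" "act X r - a *\<^sub>C r \<in> P"
      using eigenvector_mod[OF clinear_act _ fW _ sP, of X] by blast
    have orbW: "(act Y ^^ k) r \<in> W" for k using r(1) stW Y by (induction k) auto
    have "l (br X Y) = 0"
    proof (rule commutator_weight_zero[OF clinear_act actP clinear_act actP sP r(2,3) V0(1)])
      show "X \<in> H" "Y \<in> H" by fact+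
      show "(act Y ^^ k) r \<in> V0" for k using orbW WD(1) by blast
      show "act X (act Y ((act Y ^^ k) r)) - act Y (act X ((act Y ^^ k) r)) - l (br X Y) *\<^sub>C (act Y ^^ k) r
        \<in> cvec.span (P \<union> (\<lambda>k. (act Y ^^ k) r) ` {..<k})" for k
        using WD(2)[OF orbW[of k] brK[OF X Y]] by (intro cvec.span_base) (auto simp: act_br)
    qed
    then show ?thesis using WD(2)[OF v brK[OF X Y]] by simp
  qed
  have "\<exists>q\<in>W - P. \<forall>X\<in>act ` H. \<exists>a. X q - a *\<^sub>C q \<in> P"
  proof (rule commuting_eigenvector_mod[OF _ sP _ fW])
    show "P \<subset> W" using PW qW q by blast
    show "\<And>X. X \<in> act ` H \<Longrightarrow> clinear X" using clinear_act by blast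
    show "\<And>X. X \<in> act ` H \<Longrightarrow> X ` P \<subseteq> P" using actP by blast
    show "\<And>X. X \<in> act ` H \<Longrightarrow> X ` W \<subseteq> W" using stW by blast
    show "\<And>X Y w. X \<in> act ` H \<Longrightarrow> Y \<in> act ` H \<Longrightarrow> w \<in> W \<Longrightarrow> X (Y w) - Y (X w) \<in> P"
      using comm by (auto simp: act_br)
  qed
  then show ?case using WD(1) by blast
qed

lemma finite_dim_common_range:
  assumes "finite S"
  shows "\<exists>V0. finite_dim V0 \<and> (\<forall>X\<in>S. range (act X) \<subseteq> V0)"
proof -
  have "\<exists>A. finite A \<and> cvec.span A = range (act X)" for X
    using finite_dim_range_act by (simp add: finite_dim_def)
  then obtain A where A: "\<And>X. finite (A X)" "\<And>X. cvec.span (A X) = range (act X)" by metis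
  have "finite (\<Union>X\<in>S. A X)" using A(1) assms by blast
  then have "finite_dim (cvec.span (\<Union>X\<in>S. A X))" unfolding finite_dim_def by blast
  moreover have "range (act X) \<subseteq> cvec.span (\<Union>X\<in>S. A X)" if "X \<in> S" for X
    unfolding A(2)[symmetric] by (rule cvec.span_mono) (use that in auto)
  ultimately show ?thesis by blast
qed

lemma stable_span: "(\<And>X v. X \<in> B \<Longrightarrow> v \<in> A \<Longrightarrow> act X v \<in> cvec.span A) \<Longrightarrow> stable B (cvec.span A)"
  unfolding stable_def using clinear_span_image_subset[OF clinear_act cvec.subspace_span] by blast

lemma stable_add_line:
  assumes "stable B P" "\<And>X. X \<in> B \<Longrightarrow> \<exists>a. act X q - a *\<^sub>C q \<in> P"
  shows "stable B (cvec.span (insert q P))"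
proof (rule stable_span)
  fix X v assume X: "X \<in> B" and v: "v \<in> insert q P"
  show "act X v \<in> cvec.span (insert q P)"
  proof (cases "v = q")
    case True
    then show ?thesis
      unfolding cvec.span_breakdown_eq using assms(2)[OF X] cvec.span_base by blast
  next
    case False
    then show ?thesis using v stableD[OF assms(1) X] by (auto intro!: cvec.span_base)
  qed
qed

definition closed_irreducible :: "('v, 'w) tensor set \<Rightarrow> 'v set \<Rightarrow> 'v set \<Rightarrow> bool"
  where "closed_irreducible B F G \<longleftrightarrow> cvec.subspace F \<and> cvec.subspace G \<and> pclosure p F = F \<and>
    pclosure p G = G \<and> stable B F \<and> stable B G \<and> F \<subset> G \<and>
    \<not> (\<exists>E. cvec.subspace E \<and> pclosure p E = E \<and> stable B E \<and> F \<subset> E \<and> E \<subset> G)"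

lemma closed_irreducibleD:
  assumes "closed_irreducible B F G" "cvec.subspace E" "pclosure p E = E" "stable B E" "F \<subseteq> E" "E \<subseteq> G"
    "x \<in> E" "x \<notin> F"
  shows "E = G"
  using assms unfolding closed_irreducible_def by blast

text \<open>The orbit \<open>O\<close> of \<open>u\<close> is dense modulo \<open>F\<close>, so \<open>u = Z m = Z t\<close> for some \<open>t\<close> in \<open>F + O\<close>. Only
  finitely many elements of \<open>B\<close> are involved in \<open>t\<close>; by Lie's theorem these act triangularly on a
  finite-dimensional space modulo \<open>F\<close>, where \<open>Z\<close> lowers the filtration. Hence \<open>u\<close> lies in \<open>F\<close>.\<close>

lemma commutator_acts_trivially:
  assumes B: "locally_solvable_algebra br B" and irr: "closed_irreducible B F G"
    and X: "X \<in> B" and Y: "Y \<in> B" and m: "m \<in> G"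
  shows "act (br X Y) m \<in> F"
proof (rule ccontr)
  define Z where "Z = br X Y"
  define u where "u = act Z m"
  assume "act (br X Y) m \<notin> F"
  then have uF: "u \<notin> F" by (simp add: u_def Z_def)
  have lieB: "lie_subalgebra br B"
    using B by (simp add: locally_solvable_algebra_def locally_finite_algebra_def)
  have ZB: "Z \<in> B" using lieB X Y by (simp add: Z_def lie_subalgebra_def)
  have F: "cvec.subspace F" "stable B F" and G: "cvec.subspace G" "pclosure p G = G" "stable B G" and FG: "F \<subseteq> G"
    using irr by (auto simp: closed_irreducible_def)
  have uG: "u \<in> G" using m stableD[OF G(3) ZB] by (simp add: u_def)
  define gen where "gen S y \<longleftrightarrow> (\<forall>Q. cvec.subspace Q \<and> stable S Q \<and> u \<in> Q \<longrightarrow> y \<in> Q)" for S y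
  have gen_mono: "gen S y \<Longrightarrow> S \<subseteq> T \<Longrightarrow> gen T y" for S T y
    unfolding gen_def using stable_mono by blast
  define O' where "O' = {y. \<exists>S. finite S \<and> S \<subseteq> B \<and> gen S y}"
  have sO: "cvec.subspace O'"
  proof (rule cvec.subspaceI)
    have "gen {} 0" by (auto simp: gen_def intro: cvec.subspace_0)
    then show "0 \<in> O'" unfolding O'_def by blast
    fix x y c assume "x \<in> O'"
    then obtain S where S: "finite S" "S \<subseteq> B" "gen S x" by (auto simp: O'_def)
    have "gen S (c *\<^sub>C x)" using S(3) by (auto simp: gen_def intro: cvec.subspace_scale)
    then show "c *\<^sub>C x \<in> O'" using S unfolding O'_def by blast
    assume "y \<in> O'"
    then obtain T where T: "finite T" "T \<subseteq> B" "gen T y" by (auto simp: O'_def)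
    have "gen (S \<union> T) x" "gen (S \<union> T) y" using gen_mono S(3) T(3) by blast+
    then have "gen (S \<union> T) (x + y)" by (auto simp: gen_def intro: cvec.subspace_add)
    then show "x + y \<in> O'" using S T unfolding O'_def by blast
  qed
  have stO: "stable B O'"
    unfolding stable_def
  proof (intro ballI)
    fix T y assume T: "T \<in> B" "y \<in> O'"
    then obtain S where S: "finite S" "S \<subseteq> B" "gen S y" by (auto simp: O'_def)
    have "gen (insert T S) y" using gen_mono S(3) by blast
    then have "gen (insert T S) (act T y)" unfolding gen_def using stableD by blast
    then show "act T y \<in> O'" using S T unfolding O'_def by blast
  qed
  have "gen {} u" by (auto simp: gen_def)
  then have uO: "u \<in> O'" unfolding O'_def by blast
  have OG: "O' \<subseteq> G"
  proof
    fix y assume "y \<in> O'"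
    then obtain S where "S \<subseteq> B" "gen S y" by (auto simp: O'_def)
    then show "y \<in> G" using G uG stable_mono unfolding gen_def by blast
  qed
  define E where "E = cvec.span (F \<union> O')"
  have "stable B E"
    unfolding E_def by (rule stable_span) (use stableD[OF F(2)] stableD[OF stO] in \<open>auto intro!: cvec.span_base\<close>)
  then have "stable B (pclosure p E)" by (rule stable_pclosure)
  moreover have "F \<subseteq> E" "O' \<subseteq> E" unfolding E_def using cvec.span_superset by blast+
  then have "F \<subseteq> pclosure p E" "u \<in> pclosure p E" using pclosure_superset[of E] uO by blast+
  moreover have "E \<subseteq> G" unfolding E_def by (rule cvec.span_minimal) (use FG OG G(1) in auto)
  then have "pclosure p E \<subseteq> G" using G(2) by (rule pclosure_minimal)
  ultimately have "pclosure p E = G"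
    using closed_irreducibleD[OF irr subspace_pclosure pclosure_idem _ _ _ _ uF] by blast
  then obtain t where t: "t \<in> E" "act Z t = u"
    using act_pclosure[of E m Z] m unfolding E_def u_def by auto
  have spans: "cvec.span F = F" "cvec.span O' = O'" using F(1) sO by (simp_all only: cvec.span_eq_iff)
  obtain f y where fy: "t = f + y" "f \<in> F" "y \<in> O'"
    using t(1) unfolding E_def cvec.span_Un spans by blast
  then obtain S where S: "finite S" "S \<subseteq> B" "gen S y" by (auto simp: O'_def)
  have fin: "finite (insert X (insert Y S))" and sub: "insert X (insert Y S) \<subseteq> B" using S X Y by auto
  obtain H where H: "lie_subalgebra br H" "H \<subseteq> B" "insert X (insert Y S) \<subseteq> H" "solvable_algebra br H"
    using B fin sub unfolding locally_solvable_algebra_def by blast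
  obtain n where n: "(derived_algebra br ^^ n) H = {0}" using H(4) by (auto simp: solvable_algebra_def)
  obtain V0 where V0: "finite_dim V0" "\<forall>T\<in>insert X (insert Y S). range (act T) \<subseteq> V0"
    using finite_dim_common_range[OF fin] by blast
  have sV: "cvec.subspace V0" using V0(1) by (rule finite_dim_subspace)
  define H' where "H' = {T \<in> H. range (act T) \<subseteq> V0}"
  have lieH': "lie_subalgebra br H'"
    using H(1) sV unfolding lie_subalgebra_def H'_def
    by (auto simp: cvec.subspace_def act_left act_br image_subset_iff intro!: cvec.subspace_diff)
  have H'0: "(derived_algebra br ^^ n) H' \<subseteq> {0}"
    unfolding n[symmetric] by (rule derived_series_mono) (auto simp: H'_def)
  have H'sub: "X \<in> H'" "Y \<in> H'" "S \<subseteq> H'" unfolding H'_def using H(3) V0(2) by blast+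
  have H'B: "H' \<subseteq> B" using H(2) by (auto simp: H'_def)
  have stV: "stable H' V0" by (auto simp: stable_def H'_def)
  have ZV: "act Z v \<in> V0" for v
    using H'sub(1,2) sV by (auto simp: Z_def act_br H'_def image_subset_iff intro!: cvec.subspace_diff)
  have uV: "u \<in> V0" using ZV by (simp add: u_def)
  have "u \<in> P" if "cvec.subspace P" "F \<inter> V0 \<subseteq> P" "P \<subseteq> V0" "stable H' P" for P
    using that
  proof (induction "cvec.dim V0 - cvec.dim P" arbitrary: P rule: less_induct)
    case less
    show ?case
    proof (cases "P = V0")
      case True
      then show ?thesis using uV by simp
    next
      case False
      then have PV: "P \<subset> V0" using less.prems(3) by blast
      obtain q where q: "q \<in> V0" "q \<notin> P" "\<And>T. T \<in> H' \<Longrightarrow> \<exists>a. act T q - a *\<^sub>C q \<in> P"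
        using lie_theorem_mod[OF lieH' H'0 V0(1) stV less.prems(1) PV less.prems(4)] by blast
      define P1 where "P1 = cvec.span (insert q P)"
      have P1: "cvec.subspace P1" "stable H' P1" unfolding P1_def
        by (simp, rule stable_add_line[OF less.prems(4) q(3)])
      have PP1: "P \<subset> P1" "q \<in> P1" unfolding P1_def using cvec.span_superset[of "insert q P"] q(2) by blast+
      have P1V: "P1 \<subseteq> V0" unfolding P1_def by (rule cvec.span_minimal) (use q PV sV in auto)
      have fP1: "finite_dim P1" by (rule finite_dim_subset[OF V0(1) P1(1) P1V])
      have "cvec.dim P < cvec.dim V0" "cvec.dim P < cvec.dim P1"
        using dim_strict_mono less.prems(1) V0(1) fP1 PV PP1(1) by blast+
      then have "cvec.dim V0 - cvec.dim P1 < cvec.dim V0 - cvec.dim P" by linarith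
      then have "u \<in> P1" using less.hyps[of P1] P1 P1V PP1(1) less.prems(2) by blast
      then have "y \<in> P1" using S(3) H'sub(3) P1 stable_mono unfolding gen_def by blast
      then obtain c where c: "y - c *\<^sub>C q \<in> P"
        using less.prems(1) unfolding P1_def cvec.span_breakdown_eq by (auto simp: cvec.span_eq_iff[THEN iffD2])
      obtain a b where ab: "act X q - a *\<^sub>C q \<in> P" "act Y q - b *\<^sub>C q \<in> P" using q(3) H'sub by meson
      note st = stableD[OF less.prems(4)]
      have "act X (act Y q - b *\<^sub>C q) \<in> P" "act Y (act X q - a *\<^sub>C q) \<in> P" using st H'sub ab by blast+
      moreover have "b *\<^sub>C (act X q - a *\<^sub>C q) - a *\<^sub>C (act Y q - b *\<^sub>C q) \<in> P"
        using cvec.subspace_diff[OF less.prems(1) cvec.subspace_scale[OF less.prems(1) ab(1)]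
            cvec.subspace_scale[OF less.prems(1) ab(2)]] .
      ultimately have "(act X (act Y q - b *\<^sub>C q) - act Y (act X q - a *\<^sub>C q))
          + (b *\<^sub>C (act X q - a *\<^sub>C q) - a *\<^sub>C (act Y q - b *\<^sub>C q)) \<in> P"
        by (metis cvec.subspace_add cvec.subspace_diff less.prems(1))
      then have Zq: "act Z q \<in> P"
        by (simp add: Z_def act_br act_right cvec.scale_right_diff_distrib mult.commute)
      have Zst: "act Z v \<in> P" if "v \<in> P" for v
        using that st H'sub less.prems(1) by (auto simp: Z_def act_br intro!: cvec.subspace_diff)
      have "act Z f \<in> P" using ZV fy(2) stableD[OF F(2) ZB] less.prems(2) by blast
      moreover have "act Z (y - c *\<^sub>C q) \<in> P" using Zst c by blast
      moreover have "c *\<^sub>C act Z q \<in> P" using Zq less.prems(1) by (rule cvec.subspace_scale[rotated])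
      ultimately have "act Z f + (act Z (y - c *\<^sub>C q) + c *\<^sub>C act Z q) \<in> P"
        using less.prems(1) by (intro cvec.subspace_add)
      then show ?thesis using t(2) by (simp add: fy(1) act_right)
    qed
  qed
  from this[of "F \<inter> V0"] have "u \<in> F"
    using cvec.subspace_inter[OF F(1) sV] stV F(2) H'B unfolding stable_def by blast
  then show False using uF by blast
qed

lemma closed_irreducible_line:
  assumes B: "locally_solvable_algebra br B" and irr: "closed_irreducible B F G" and x: "x \<in> G" "x \<notin> F"
  shows "G = cvec.span (insert x F)"
proof -
  have F: "cvec.subspace F" "pclosure p F = F" "stable B F"
    and G: "cvec.subspace G" "pclosure p G = G" "stable B G" and FG: "F \<subseteq> G"
    using irr by (auto simp: closed_irreducible_def)
  have scalar: "\<exists>a. \<forall>v\<in>G. act X v - a *\<^sub>C v \<in> F" if X: "X \<in> B" for X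
  proof (cases "act X ` G \<subseteq> F")
    case True
    then have "\<forall>v\<in>G. act X v - 0 *\<^sub>C v \<in> F" by auto
    then show ?thesis by blast
  next
    case False
    have sV: "cvec.subspace (act X ` G)" by (rule clinear_subspace_image[OF clinear_act G(1)])
    have fV: "finite_dim (act X ` G)"
      by (rule finite_dim_subset[OF finite_dim_range_act sV]) blast
    have VG: "act X ` G \<subseteq> G" using stableD[OF G(3) X] by blast
    obtain q a where q: "q \<in> act X ` G" "q \<notin> F" "act X q - a *\<^sub>C q \<in> F"
      using eigenvector_mod[OF clinear_act _ fV False F(1), of X] VG by blast
    define K where "K = G \<inter> {v. act X v - a *\<^sub>C v \<in> F}"
    have "cvec.subspace K" unfolding K_def
      by (intro cvec.subspace_inter G(1) clinear_subspace_vimage clinear_diff_scale clinear_act F(1))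
    moreover have "pclosure p K = K"
      using pclosure_Inter[of "{G, {v. act X v - a *\<^sub>C v \<in> F}}"] G(2) closed_eigenspace[OF F(2)]
      by (auto simp: K_def)
    moreover have "stable B K"
      unfolding stable_def
    proof (intro ballI)
      fix Y v assume Y: "Y \<in> B" and v: "v \<in> K"
      have "act Y (act X v - a *\<^sub>C v) \<in> F" using v stableD[OF F(3) Y] by (auto simp: K_def)
      moreover have "act (br X Y) v \<in> F"
        using commutator_acts_trivially[OF B irr X Y] v by (auto simp: K_def)
      ultimately have "act Y (act X v - a *\<^sub>C v) + act (br X Y) v \<in> F"
        using F(1) by (intro cvec.subspace_add)
      then have "act X (act Y v) - a *\<^sub>C act Y v \<in> F" by (simp add: act_right act_br)
      then show "act Y v \<in> K" using v stableD[OF G(3) Y] by (auto simp: K_def)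
    qed
    moreover have "F \<subseteq> K"
      using FG stableD[OF F(3) X] F(1) by (auto simp: K_def intro!: cvec.subspace_diff cvec.subspace_scale)
    moreover have "q \<in> K" using q VG by (auto simp: K_def)
    ultimately have "K = G" using closed_irreducibleD[OF irr _ _ _ _ _ _ q(2)] by (auto simp: K_def)
    then show ?thesis by (auto simp: K_def)
  qed
  have "stable B (cvec.span (insert x F))"
    by (rule stable_add_line[OF F(3)]) (use scalar x in blast)
  moreover have "cvec.span (insert x F) \<subseteq> G" by (rule cvec.span_minimal) (use x FG G(1) in auto)
  moreover have "F \<subseteq> cvec.span (insert x F)" "x \<in> cvec.span (insert x F)"
    using cvec.span_superset[of "insert x F"] by auto
  ultimately show ?thesis
    using closed_irreducibleD[OF irr cvec.subspace_span closed_add_line[OF F(1,2)] _ _ _ _ x(2)] by blast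
qed

end

section \<open>Closed generalized flags and their stabilizers\<close>

lemma imm_pair_cases:
  assumes "\<forall>F\<in>C. \<forall>G\<in>C. F \<subseteq> G \<or> G \<subseteq> F" "imm_pair C F G" "x \<in> G - F" "E \<in> C"
  shows "x \<in> E \<Longrightarrow> G \<subseteq> E" "x \<notin> E \<Longrightarrow> E \<subseteq> F"
proof -
  have C: "F \<in> C" "G \<in> C" "F \<subset> G" "\<not> (F \<subset> E \<and> E \<subset> G)"
    using assms(2,4) by (auto simp: imm_pair_def)
  have EF: "E \<subseteq> F \<or> F \<subseteq> E" and EG: "E \<subseteq> G \<or> G \<subseteq> E" using assms(1,4) C by blast+
  show "G \<subseteq> E" if "x \<in> E" using that EF EG C(4) assms(3) by blast
  show "E \<subseteq> F" if "x \<notin> E" using that EF EG C(4) assms(3) by blast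
qed

lemma imm_pair_unique:
  assumes "\<forall>F\<in>C. \<forall>G\<in>C. F \<subseteq> G \<or> G \<subseteq> F" "imm_pair C F G" "x \<in> G - F" "imm_pair C F' G'" "x \<in> G' - F'"
  shows "F' = F" "G' = G"
proof -
  have "F \<in> C" "G \<in> C" "F' \<in> C" "G' \<in> C" using assms(2,4) by (auto simp: imm_pair_def)
  then show "F' = F" "G' = G"
    using imm_pair_cases[OF assms(1,2,3)] imm_pair_cases[OF assms(1,4,5)] assms(3,5) by blast+
qed

lemma flag_chain: "generalized_flag C \<Longrightarrow> \<forall>F\<in>C. \<forall>G\<in>C. F \<subseteq> G \<or> G \<subseteq> F"
  by (simp add: generalized_flag_def)

lemma flag_subspace: "generalized_flag C \<Longrightarrow> F \<in> C \<Longrightarrow> cvec.subspace F"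
  by (simp add: generalized_flag_def)

lemma flag_pair:
  assumes "generalized_flag C" "x \<noteq> 0"
  obtains F G where "imm_pair C F G" "x \<in> G" "x \<notin> F"
  using assms unfolding generalized_flag_def by blast

lemma flag_member_pair:
  assumes "generalized_flag C" "E \<in> C"
  obtains F G x where "imm_pair C F G" "x \<in> G - F" "x \<noteq> 0" "E = F \<or> E = G"
proof -
  have "(\<exists>G. imm_pair C G E) \<or> (\<exists>G. imm_pair C E G)" using assms by (simp add: generalized_flag_def)
  then obtain F G where FG: "imm_pair C F G" "E = F \<or> E = G" by blast
  then obtain x where "x \<in> G - F" by (auto simp: imm_pair_def)
  moreover have "0 \<in> F" using FG(1) flag_subspace[OF assms(1)] cvec.subspace_0 by (auto simp: imm_pair_def)
  ultimately show thesis using that FG by blast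
qed

context pairing
begin

lemma closed_flagD:
  assumes "closed_flag p C"
  shows "generalized_flag C" "imm_pair C F G \<Longrightarrow> pclosure p G = G"
    "imm_pair C F G \<Longrightarrow> pclosure p F = F \<or> pclosure p F = G"
  using assms by (auto simp: closed_flag_def)

lemma maximal_chain_exists:
  assumes C0: "\<And>E. E \<in> C0 \<Longrightarrow> Q E" "\<And>E E'. E \<in> C0 \<Longrightarrow> E' \<in> C0 \<Longrightarrow> E \<subseteq> E' \<or> E' \<subseteq> E"
  obtains M where "C0 \<subseteq> M" "\<And>E. E \<in> M \<Longrightarrow> Q E" "\<And>E E'. E \<in> M \<Longrightarrow> E' \<in> M \<Longrightarrow> E \<subseteq> E' \<or> E' \<subseteq> E"
    "\<And>E. Q E \<Longrightarrow> (\<And>E'. E' \<in> M \<Longrightarrow> E \<subseteq> E' \<or> E' \<subseteq> E) \<Longrightarrow> E \<in> M"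
proof -
  define \<A> where "\<A> = {M. C0 \<subseteq> M \<and> (\<forall>E\<in>M. Q E) \<and> (\<forall>E\<in>M. \<forall>E'\<in>M. E \<subseteq> E' \<or> E' \<subseteq> E)}"
  have "\<exists>M\<in>\<A>. \<forall>X\<in>\<A>. M \<subseteq> X \<longrightarrow> X = M"
  proof (rule subset_Zorn_nonempty)
    have "C0 \<in> \<A>" using C0 by (simp add: \<A>_def)
    then show "\<A> \<noteq> {}" by blast
    fix \<C> assume ne: "\<C> \<noteq> {}" and ch: "subset.chain \<A> \<C>"
    have sub: "\<C> \<subseteq> \<A>" and tot: "\<And>M N. M \<in> \<C> \<Longrightarrow> N \<in> \<C> \<Longrightarrow> M \<subseteq> N \<or> N \<subseteq> M"
      using ch by (auto simp: subset.chain_def)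
    have "E \<subseteq> E' \<or> E' \<subseteq> E" if EE: "E \<in> \<Union>\<C>" "E' \<in> \<Union>\<C>" for E E'
    proof -
      obtain M N where MN: "M \<in> \<C>" "N \<in> \<C>" "E \<in> M" "E' \<in> N" using EE by blast
      then obtain K where "K \<in> \<C>" "E \<in> K" "E' \<in> K" using tot[OF MN(1,2)] by blast
      then show ?thesis using sub unfolding \<A>_def by blast
    qed
    moreover have "C0 \<subseteq> \<Union>\<C>" "\<forall>E\<in>\<Union>\<C>. Q E" using ne sub unfolding \<A>_def by blast+
    ultimately show "\<Union>\<C> \<in> \<A>" unfolding \<A>_def by blast
  qed
  then obtain M where M: "M \<in> \<A>" "\<And>X. X \<in> \<A> \<Longrightarrow> M \<subseteq> X \<Longrightarrow> X = M" by blast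
  have "E \<in> M" if "Q E" "\<And>E'. E' \<in> M \<Longrightarrow> E \<subseteq> E' \<or> E' \<subseteq> E" for E
  proof -
    have "insert E M \<in> \<A>" using M(1) that unfolding \<A>_def by blast
    then show ?thesis using M(2) by blast
  qed
  then show thesis using that[of M] M(1) unfolding \<A>_def by blast
qed

lemma maximal_chain_flag:
  assumes C0: "\<And>E. E \<in> C0 \<Longrightarrow> cvec.subspace E \<and> pclosure p E = E \<and> stable B E"
    "\<And>E E'. E \<in> C0 \<Longrightarrow> E' \<in> C0 \<Longrightarrow> E \<subseteq> E' \<or> E' \<subseteq> E"
  obtains D where "closed_flag p D" "\<And>E. E \<in> D \<Longrightarrow> stable B E"
    "\<And>F G. imm_pair D F G \<Longrightarrow> pclosure p F = F \<Longrightarrow> closed_irreducible B F G"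
    "\<And>F G x E. imm_pair D F G \<Longrightarrow> x \<in> G - F \<Longrightarrow> E \<in> C0 \<Longrightarrow> x \<in> E \<Longrightarrow> G \<subseteq> E"
    "\<And>F G x E. imm_pair D F G \<Longrightarrow> x \<in> G - F \<Longrightarrow> E \<in> C0 \<Longrightarrow> x \<notin> E \<Longrightarrow> E \<subseteq> F"
proof -
  define Q where "Q E \<longleftrightarrow> cvec.subspace E \<and> pclosure p E = E \<and> stable B E" for E
  obtain M where M: "C0 \<subseteq> M" and MQ: "\<And>E. E \<in> M \<Longrightarrow> Q E"
    and Mch: "\<And>E E'. E \<in> M \<Longrightarrow> E' \<in> M \<Longrightarrow> E \<subseteq> E' \<or> E' \<subseteq> E"
    and Mmax: "\<And>E. Q E \<Longrightarrow> (\<And>E'. E' \<in> M \<Longrightarrow> E \<subseteq> E' \<or> E' \<subseteq> E) \<Longrightarrow> E \<in> M"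
    using maximal_chain_exists[of C0 Q] C0 unfolding Q_def by blast
  have M0: "{0} \<in> M"
  proof (rule Mmax)
    show "Q {0}" by (simp add: Q_def pclosure_0 stable_def act_right)
    show "{0} \<subseteq> E \<or> E \<subseteq> {0}" if "E \<in> M" for E
      using MQ[OF that] cvec.subspace_0 unfolding Q_def by blast
  qed
  have MU: "UNIV \<in> M" by (rule Mmax) (simp_all add: Q_def pclosure_UNIV stable_def)
  define P R where "P x = \<Union>{E\<in>M. x \<notin> E}" and "R x = \<Inter>{E\<in>M. x \<in> E}" for x
  have Pup: "E \<subseteq> P x" if "E \<in> M" "x \<notin> E" for E x using that by (auto simp: P_def)
  have Rlow: "R x \<subseteq> E" if "E \<in> M" "x \<in> E" for E x using that by (auto simp: R_def)
  have Plow: "P x \<subseteq> E" if "E \<in> M" "x \<in> E" for E x using that Mch unfolding P_def by blast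
  have Rup: "E \<subseteq> R x" if "E \<in> M" "x \<notin> E" for E x using that Mch unfolding R_def by blast
  have xP: "x \<notin> P x" and xR: "x \<in> R x" for x by (auto simp: P_def R_def)
  have PR: "P x \<subseteq> R x" for x using Plow unfolding R_def by blast
  have RM: "R x \<in> M" for x
  proof (rule Mmax)
    have "cvec.subspace (R x)" unfolding R_def by (rule cvec.subspace_Inter) (use MQ in \<open>auto simp: Q_def\<close>)
    moreover have "pclosure p (R x) = R x" unfolding R_def by (rule pclosure_Inter) (use MQ in \<open>auto simp: Q_def\<close>)
    moreover have "stable B (R x)" using MQ by (auto simp: R_def stable_def Q_def)
    ultimately show "Q (R x)" by (simp add: Q_def)
    show "R x \<subseteq> E \<or> E \<subseteq> R x" if "E \<in> M" for E using Rlow Rup that by blast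
  qed
  have sP: "cvec.subspace (P x)" if "x \<noteq> 0" for x
  proof (rule cvec.subspaceI)
    show "0 \<in> P x" using M0 that unfolding P_def by blast
    show "c *\<^sub>C u \<in> P x" if u: "u \<in> P x" for c u
    proof -
      obtain E where "E \<in> M" "x \<notin> E" "u \<in> E" using u by (auto simp: P_def)
      then show ?thesis using MQ[of E] Pup unfolding Q_def by (meson cvec.subspace_scale subsetD)
    qed
    show "u + v \<in> P x" if uv: "u \<in> P x" "v \<in> P x" for u v
    proof -
      obtain E E' where E: "E \<in> M" "x \<notin> E" "u \<in> E" "E' \<in> M" "x \<notin> E'" "v \<in> E'" using uv by (auto simp: P_def)
      then obtain K where "K \<in> M" "x \<notin> K" "u \<in> K" "v \<in> K" using Mch[of E E'] by blast
      then show ?thesis using MQ[of K] Pup unfolding Q_def by (meson cvec.subspace_add subsetD)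
    qed
  qed
  have stP: "stable B (P x)" for x using MQ unfolding P_def stable_def Q_def by blast
  have clP: "pclosure p (P x) = P x \<or> pclosure p (P x) = R x" for x
  proof -
    have low: "pclosure p (P x) \<subseteq> E" if "E \<in> M" "x \<in> E" for E
      using pclosure_minimal[OF Plow[OF that]] MQ[OF that(1)] by (simp add: Q_def)
    have "pclosure p (P x) \<in> M"
    proof (rule Mmax)
      show "Q (pclosure p (P x))"
        unfolding Q_def using subspace_pclosure pclosure_idem stable_pclosure[OF stP] by blast
      show "pclosure p (P x) \<subseteq> E \<or> E \<subseteq> pclosure p (P x)" if "E \<in> M" for E
        using low[OF that] Pup[OF that] pclosure_superset[of "P x"] by blast
    qed
    then show ?thesis using low[OF RM xR] Rlow Pup pclosure_superset[of "P x"] by blast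
  qed
  define D where "D = P ` (-{0}) \<union> R ` (-{0})"
  have DM: "E \<subseteq> K \<or> K \<subseteq> E" if "E \<in> D" "K \<in> M" for E K
    using that Mch[OF RM] Plow Pup unfolding D_def by blast
  have Dch: "E \<subseteq> E' \<or> E' \<subseteq> E" if ED: "E \<in> D" "E' \<in> D" for E E'
  proof -
    consider x where "E' = P x" | x where "E' = R x" using ED(2) by (auto simp: D_def)
    then show ?thesis
    proof cases
      case (1 x)
      show ?thesis
      proof (cases "\<forall>K\<in>M. x \<notin> K \<longrightarrow> K \<subseteq> E")
        case True
        then show ?thesis unfolding 1 P_def by blast
      next
        case False
        then show ?thesis using DM[OF ED(1)] Pup unfolding 1 by blast
      qed
    next
      case 2
      then show ?thesis using DM[OF ED(1) RM] by blast
    qed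
  qed
  then have Dchain: "\<forall>E\<in>D. \<forall>E'\<in>D. E \<subseteq> E' \<or> E' \<subseteq> E" by blast
  have imm: "imm_pair D (P x) (R x)" if "x \<noteq> 0" for x
  proof -
    have "\<not> (P x \<subset> E \<and> E \<subset> R x)" if ED: "E \<in> D" for E
    proof -
      consider y where "E = P y" | y where "E = R y" using ED by (auto simp: D_def)
      then show ?thesis
      proof cases
        case (1 y)
        show ?thesis
        proof (cases "x \<in> P y")
          case True
          then obtain K where "K \<in> M" "y \<notin> K" "x \<in> K" by (auto simp: P_def)
          then show ?thesis using Rlow[of K x] Pup[of K y] unfolding 1 by blast
        next
          case False
          then have "P y \<subseteq> P x" unfolding P_def by blast
          then show ?thesis unfolding 1 by blast
        qed
      next
        case (2 y)
        then show ?thesis using Rlow[OF RM[of y]] Pup[OF RM[of y]] by blast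
      qed
    qed
    then show ?thesis using that PR[of x] xP[of x] xR[of x] unfolding imm_pair_def D_def by blast
  qed
  have pairD: "F = P x \<and> G = R x \<and> x \<noteq> 0" if "imm_pair D F G" "x \<in> G - F" for F G x
  proof -
    have "x \<noteq> 0"
    proof
      assume "x = 0"
      moreover have "F \<in> D" using that(1) by (simp add: imm_pair_def)
      then have "0 \<in> F" using sP cvec.subspace_0 MQ[OF RM] unfolding D_def Q_def by blast
      ultimately show False using that(2) by blast
    qed
    then show ?thesis using imm_pair_unique[OF Dchain imm[of x] _ that] xP xR by blast
  qed
  have ex: "\<exists>x. x \<in> G - F" if "imm_pair D F G" for F G using that by (auto simp: imm_pair_def)
  have "generalized_flag D"
    unfolding generalized_flag_def
  proof (intro conjI ballI allI impI)
    show "cvec.subspace F" if "F \<in> D" for F using that sP MQ[OF RM] by (auto simp: D_def Q_def)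
    show "F \<subseteq> G \<or> G \<subseteq> F" if "F \<in> D" "G \<in> D" for F G using Dch that by blast
    show "(\<exists>G. imm_pair D G F) \<or> (\<exists>G. imm_pair D F G)" if "F \<in> D" for F
      using that imm unfolding D_def by blast
    show "\<exists>F' F''. imm_pair D F' F'' \<and> x \<in> F'' - F'" if "x \<noteq> 0" for x
      using imm[OF that] xP xR by blast
  qed
  moreover have "pclosure p G = G \<and> (pclosure p F = F \<or> pclosure p F = G)" if FG: "imm_pair D F G" for F G
  proof -
    obtain x where "x \<in> G - F" using ex[OF FG] by blast
    then show ?thesis using pairD[OF FG] clP MQ[OF RM] unfolding Q_def by blast
  qed
  ultimately have "closed_flag p D" unfolding closed_flag_def by blast
  moreover have stD: "stable B E" if "E \<in> D" for E using that stP MQ[OF RM] by (auto simp: D_def Q_def)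
  moreover have "closed_irreducible B F G" if FG: "imm_pair D F G" and cl: "pclosure p F = F" for F G
  proof -
    obtain x where x: "x \<in> G - F" using ex[OF FG] by blast
    then have F: "F = P x" and G: "G = R x" and x0: "x \<noteq> 0" using pairD[OF FG] by auto
    have none: "\<not> (F \<subset> E \<and> E \<subset> G)" if "Q E" for E
    proof
      assume E: "F \<subset> E \<and> E \<subset> G"
      have "E \<in> M"
      proof (rule Mmax[OF that])
        fix K assume K: "K \<in> M"
        show "E \<subseteq> K \<or> K \<subseteq> E"
          using Rlow[OF K, of x] Pup[OF K, of x] E unfolding F G by blast
      qed
      then show False using Rlow[of E x] Pup[of E x] E unfolding F G by blast
    qed
    have "F \<subset> G" using FG by (simp add: imm_pair_def)
    moreover have "Q F" "Q G" using cl sP[OF x0] stP[of x] MQ[OF RM[of x]] by (simp_all add: Q_def F G)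
    ultimately show ?thesis using none unfolding closed_irreducible_def Q_def by metis
  qed
  moreover have "G \<subseteq> E" if "imm_pair D F G" "x \<in> G - F" "E \<in> C0" "x \<in> E" for F G x E
    using pairD[OF that(1,2)] Rlow[of E x] that M by blast
  moreover have "E \<subseteq> F" if "imm_pair D F G" "x \<in> G - F" "E \<in> C0" "x \<notin> E" for F G x E
    using pairD[OF that(1,2)] Pup[of E x] that M by blast
  ultimately show thesis by (rule that)
qed

definition line_pairs :: "'v set set \<Rightarrow> bool"
  where "line_pairs C \<longleftrightarrow> (\<forall>F G x. imm_pair C F G \<and> pclosure p F = F \<and> x \<in> G - F \<longrightarrow> G = cvec.span (insert x F))"

lemma maximal_closed_flag_if_line_pairs:
  assumes C: "closed_flag p C" "line_pairs C"
  shows "maximal_closed_flag p C"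
  unfolding maximal_closed_flag_def
proof (intro conjI allI impI C(1))
  fix D assume D: "closed_flag p D \<and> refines D C"
  note gC = closed_flagD(1)[OF C(1)]
  have gD: "generalized_flag D" using D closed_flagD(1) by blast
  note chC = flag_chain[OF gC] and chD = flag_chain[OF gD]
  have ref: "F \<subseteq> F'" "G' \<subseteq> G"
    if "x \<noteq> 0" "imm_pair C F G" "x \<in> G - F" "imm_pair D F' G'" "x \<in> G' - F'" for x F G F' G'
    using D that unfolding refines_def by blast+
  have dense: "G' = G"
    if "x \<noteq> 0" "imm_pair C F G" "x \<in> G - F" "imm_pair D F' G'" "x \<in> G' - F'" "pclosure p F = G" for x F G F' G'
  proof -
    have "F \<subseteq> G'" using ref(1)[OF that(1-5)] that(4) by (auto simp: imm_pair_def)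
    moreover have "pclosure p G' = G'" using D that(4) closed_flagD(2) by blast
    ultimately have "G \<subseteq> G'" using pclosure_minimal that(6) by blast
    then show ?thesis using ref(2)[OF that(1-5)] by blast
  qed
  have eq: "F' = F \<and> G' = G"
    if h: "x \<noteq> 0" "imm_pair C F G" "x \<in> G - F" "imm_pair D F' G'" "x \<in> G' - F'" for x F G F' G'
  proof -
    note r = ref[OF h]
    have FC: "F \<in> C" and FD: "F' \<in> D" "G' \<in> D" "F' \<subseteq> G'" using h(2,4) by (auto simp: imm_pair_def)
    have sF: "cvec.subspace F" and sF': "cvec.subspace F'" and sG': "cvec.subspace G'"
      using flag_subspace gC gD FC FD by blast+
    show ?thesis
    proof (cases "pclosure p F = F")
      case True
      then have G: "G = cvec.span (insert x F)" using C(2) h(2,3) unfolding line_pairs_def by blast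
      have "G \<subseteq> G'" unfolding G by (rule cvec.span_minimal) (use h(5) r(1) FD(3) sG' in auto)
      moreover have "z \<in> F" if z: "z \<in> F'" for z
      proof -
        have "z \<in> cvec.span (insert x F)" using z FD(3) r(2) G by blast
        then obtain c where c: "z - c *\<^sub>C x \<in> F"
          using sF unfolding cvec.span_breakdown_eq by (metis cvec.span_eq_iff)
        have "z - (z - c *\<^sub>C x) \<in> F'" by (rule cvec.subspace_diff[OF sF' z]) (use c r(1) in auto)
        then have "c = 0" using subspace_scale_cancel[OF sF', of c x] h(5) by auto
        then show ?thesis using c by simp
      qed
      ultimately show ?thesis using r by blast
    next
      case False
      then have dn: "pclosure p F = G" using closed_flagD(3)[OF C(1) h(2)] by blast
      have GG: "G' = G" by (rule dense[OF h dn])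
      have "z \<in> F" if z: "z \<in> F'" for z
      proof (rule ccontr)
        assume zF: "z \<notin> F"
        then have z0: "z \<noteq> 0" using cvec.subspace_0[OF sF] by blast
        have zG: "z \<in> G - F" using z FD(3) GG zF by blast
        obtain F1 G1 where 1: "imm_pair D F1 G1" "z \<in> G1" "z \<notin> F1" by (rule flag_pair[OF gD z0])
        have "G1 = G" by (rule dense[OF z0 h(2) zG 1(1) _ dn]) (use 1 in blast)
        moreover have "G1 \<subseteq> F'" using imm_pair_cases(1)[OF chD 1(1) _ FD(1) z] 1 by blast
        ultimately show False using h(5) GG by blast
      qed
      then show ?thesis using GG r by blast
    qed
  qed
  have "E \<in> C" if E: "E \<in> D" for E
  proof -
    obtain F' G' x where 1: "imm_pair D F' G'" "x \<in> G' - F'" "x \<noteq> 0" "E = F' \<or> E = G'"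
      by (rule flag_member_pair[OF gD E])
    obtain F G where "imm_pair C F G" "x \<in> G" "x \<notin> F" by (rule flag_pair[OF gC 1(3)])
    then show ?thesis using eq[OF 1(3) _ _ 1(1,2)] 1(4) unfolding imm_pair_def by blast
  qed
  moreover have "E \<in> D" if E: "E \<in> C" for E
  proof -
    obtain F G x where 1: "imm_pair C F G" "x \<in> G - F" "x \<noteq> 0" "E = F \<or> E = G"
      by (rule flag_member_pair[OF gC E])
    obtain F' G' where "imm_pair D F' G'" "x \<in> G'" "x \<notin> F'" by (rule flag_pair[OF gD 1(3)])
    then show ?thesis using eq[OF 1(3) 1(1,2)] 1(4) unfolding imm_pair_def by blast
  qed
  ultimately show "D = C" by blast
qed

lemma maximal_closed_flag_line_pairs:
  assumes C: "maximal_closed_flag p C"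
  shows "line_pairs C"
proof -
  have cC: "closed_flag p C" using C by (simp add: maximal_closed_flag_def)
  note gC = closed_flagD(1)[OF cC]
  note chC = flag_chain[OF gC]
  define C0 where "C0 = {G. \<exists>F. imm_pair C F G}"
  have C0C: "C0 \<subseteq> C" by (auto simp: C0_def imm_pair_def)
  obtain D where D: "closed_flag p D"
    and irr: "\<And>F G. imm_pair D F G \<Longrightarrow> pclosure p F = F \<Longrightarrow> closed_irreducible {} F G"
    and le: "\<And>F G x E. imm_pair D F G \<Longrightarrow> x \<in> G - F \<Longrightarrow> E \<in> C0 \<Longrightarrow> x \<in> E \<Longrightarrow> G \<subseteq> E"
    and ge: "\<And>F G x E. imm_pair D F G \<Longrightarrow> x \<in> G - F \<Longrightarrow> E \<in> C0 \<Longrightarrow> x \<notin> E \<Longrightarrow> E \<subseteq> F"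
  proof (rule maximal_chain_flag[of C0 "{}"])
    show "cvec.subspace E \<and> pclosure p E = E \<and> stable {} E" if "E \<in> C0" for E
      using that C0C flag_subspace[OF gC] closed_flagD(2)[OF cC] by (auto simp: C0_def stable_def)
    show "E \<subseteq> E' \<or> E' \<subseteq> E" if "E \<in> C0" "E' \<in> C0" for E E' using that C0C chC by blast
  qed blast
  note gD = closed_flagD(1)[OF D]
  have "line_pairs D"
    unfolding line_pairs_def
  proof (intro allI impI)
    fix F G x assume "imm_pair D F G \<and> pclosure p F = F \<and> x \<in> G - F"
    then have h: "imm_pair D F G" "pclosure p F = F" "x \<in> G - F" by auto
    have FG: "F \<in> D" "G \<in> D" "F \<subseteq> G" using h(1) by (auto simp: imm_pair_def)
    have "cvec.span (insert x F) = G"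
    proof (rule closed_irreducibleD[OF irr[OF h(1,2)] cvec.subspace_span])
      show "pclosure p (cvec.span (insert x F)) = cvec.span (insert x F)"
        by (rule closed_add_line[OF flag_subspace[OF gD FG(1)] h(2)])
      show "cvec.span (insert x F) \<subseteq> G"
        by (rule cvec.span_minimal) (use h(3) FG flag_subspace[OF gD] in auto)
      show "F \<subseteq> cvec.span (insert x F)" "x \<in> cvec.span (insert x F)" "x \<notin> F"
        using cvec.span_superset[of "insert x F"] h(3) by auto
    qed (simp add: stable_def)
    then show "G = cvec.span (insert x F)" ..
  qed
  moreover have "refines D C"
    unfolding refines_def
  proof (intro allI impI)
    fix x F G F' G'
    assume "x \<noteq> 0 \<and> imm_pair C F G \<and> x \<in> G - F \<and> imm_pair D F' G' \<and> x \<in> G' - F'"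
    then have h: "x \<noteq> 0" "imm_pair C F G" "x \<in> G - F" "imm_pair D F' G'" "x \<in> G' - F'" by auto
    have "F' \<in> D" using h(4) by (simp add: imm_pair_def)
    then have F'0: "0 \<in> F'" using flag_subspace[OF gD] cvec.subspace_0 by blast
    have FC: "F \<in> C" using h(2) by (simp add: imm_pair_def)
    have "y \<in> F'" if y: "y \<in> F" for y
    proof (cases "y = 0")
      case False
      obtain F1 G1 where 1: "imm_pair C F1 G1" "y \<in> G1" "y \<notin> F1" by (rule flag_pair[OF gC False])
      have "G1 \<subseteq> F" using imm_pair_cases(1)[OF chC 1(1) _ FC y] 1 by blast
      then have "G1 \<subseteq> F'" using ge[OF h(4,5)] 1(1) h(3) unfolding C0_def by blast
      then show ?thesis using 1 by blast
    qed (use F'0 in simp)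
    moreover have "G' \<subseteq> G" using le[OF h(4,5)] h(2,3) unfolding C0_def by blast
    ultimately show "F \<subseteq> F' \<and> G' \<subseteq> G" by blast
  qed
  ultimately show ?thesis using C D unfolding maximal_closed_flag_def by blast
qed

lemma stabilizer_iff: "X \<in> stabilizer p C \<longleftrightarrow> X \<in> sl p \<and> (\<forall>F\<in>C. \<forall>v\<in>F. act X v \<in> F)"
  by (auto simp: stabilizer_def)

lemma lie_subalgebra_stabilizer:
  assumes "\<And>F. F \<in> C \<Longrightarrow> cvec.subspace F"
  shows "lie_subalgebra br (stabilizer p C)"
  unfolding lie_subalgebra_def
proof
  have "cvec.subspace (sl p)" by (simp add: sl_def derived_algebra_def)
  then show "cvec.subspace (stabilizer p C)"
    using assms unfolding cvec.subspace_def by (auto simp: stabilizer_iff act_left)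
  have "br X Y \<in> sl p" for X Y unfolding sl_def derived_algebra_def by (rule cvec.span_base) auto
  then show "\<forall>X\<in>stabilizer p C. \<forall>Y\<in>stabilizer p C. br X Y \<in> stabilizer p C"
    using assms by (auto simp: stabilizer_iff act_br intro!: cvec.subspace_diff)
qed

lemma stabilizer_commutator_lowers:
  assumes C: "closed_flag p C" "line_pairs C" and X: "X \<in> stabilizer p C" and Y: "Y \<in> stabilizer p C"
    and FG: "imm_pair C F G" and v: "v \<in> G"
  shows "act (br X Y) v \<in> F"
proof -
  have mem: "F \<in> C" "G \<in> C" using FG by (auto simp: imm_pair_def)
  have sF: "cvec.subspace F" using flag_subspace[OF closed_flagD(1)[OF C(1)]] mem by blast
  have st: "\<And>T u E. T \<in> {X, Y} \<Longrightarrow> E \<in> C \<Longrightarrow> u \<in> E \<Longrightarrow> act T u \<in> E"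
    using X Y by (auto simp: stabilizer_iff)
  have line: "\<exists>a. act T v - a *\<^sub>C v \<in> F" if T: "T \<in> {X, Y}" for T
  proof (cases "pclosure p F = F")
    case True
    show ?thesis
    proof (cases "v \<in> F")
      case True
      then have "act T v - 0 *\<^sub>C v \<in> F" using st[OF T mem(1)] by simp
      then show ?thesis ..
    next
      case False
      then have "G = cvec.span (insert v F)" using C(2) FG True v unfolding line_pairs_def by blast
      then have "act T v \<in> cvec.span (insert v F)" using st[OF T mem(2) v] by simp
      then show ?thesis using sF unfolding cvec.span_breakdown_eq by (metis cvec.span_eq_iff)
    qed
  next
    case False
    then have "v \<in> pclosure p F" using closed_flagD(3)[OF C(1) FG] v by blast
    then obtain u where "u \<in> F" "act T u = act T v" using act_pclosure[OF sF] by blast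
    then have "act T v - 0 *\<^sub>C v \<in> F" using st[OF T mem(1), of u] by simp
    then show ?thesis ..
  qed
  obtain a b where ab: "act X v - a *\<^sub>C v \<in> F" "act Y v - b *\<^sub>C v \<in> F" using line by blast
  have "act X (act Y v - b *\<^sub>C v) - act Y (act X v - a *\<^sub>C v)
      + (b *\<^sub>C (act X v - a *\<^sub>C v) - a *\<^sub>C (act Y v - b *\<^sub>C v)) \<in> F"
    by (rule cvec.subspace_add[OF sF cvec.subspace_diff[OF sF st[OF _ mem(1) ab(2)] st[OF _ mem(1) ab(1)]]
          cvec.subspace_diff[OF sF cvec.subspace_scale[OF sF ab(1)] cvec.subspace_scale[OF sF ab(2)]]])
      auto
  then show ?thesis
    by (simp add: act_br act_right cvec.scale_right_diff_distrib mult.commute)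
qed

lemma span_tens_mult_closed:
  assumes "X \<in> cvec.span {a \<otimes>\<^sub>t b | a b. a \<in> A \<and> b \<in> B}" "Y \<in> cvec.span {a \<otimes>\<^sub>t b | a b. a \<in> A \<and> b \<in> B}"
  shows "gl_mult p X Y \<in> cvec.span {a \<otimes>\<^sub>t b | a b. a \<in> A \<and> b \<in> B}" (is "_ \<in> cvec.span ?S")
proof -
  have l: "clinear (\<lambda>X. gl_mult p X Z)" and r: "clinear (gl_mult p Z)" for Z
    using cbilinear_gl_mult[OF bilinear] by (auto simp: cbilinear_def)
  show ?thesis
  proof (rule clinear_span_image_subset[OF l cvec.subspace_span _ assms(1)])
    fix x assume x: "x \<in> ?S"
    show "gl_mult p x Y \<in> cvec.span ?S"
    proof (rule clinear_span_image_subset[OF r cvec.subspace_span _ assms(2)])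
      fix y assume "y \<in> ?S"
      with x obtain a b a' b' where ab: "a \<in> A" "b' \<in> B" "x = a \<otimes>\<^sub>t b" "y = a' \<otimes>\<^sub>t b'" by blast
      then have "a \<otimes>\<^sub>t b' \<in> cvec.span ?S" by (intro cvec.span_base) auto
      then show "gl_mult p x y \<in> cvec.span ?S"
        unfolding ab(3,4) gl_mult_tens[OF bilinear] by (rule cvec.span_scale)
    qed
  qed
qed

lemma stabilizer_finite_part_solvable:
  assumes C: "closed_flag p C" "line_pairs C" and V0: "finite_dim V0" and H: "lie_subalgebra br H"
    "H \<subseteq> stabilizer p C" "\<And>X v. X \<in> H \<Longrightarrow> act X v \<in> V0"
  shows "solvable_algebra br H"
proof -
  note gC = closed_flagD(1)[OF C(1)]
  note chC = flag_chain[OF gC]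
  have sV: "cvec.subspace V0" using V0 by (rule finite_dim_subspace)
  have sub: "cvec.subspace (E \<inter> V0)" if "E \<in> C" for E
    using flag_subspace[OF gC that] sV by (rule cvec.subspace_inter)
  have fin: "finite_dim (E \<inter> V0)" if "E \<in> C" for E using finite_dim_subset[OF V0 sub[OF that]] by blast
  define U where "U i = {v \<in> V0. v = 0 \<or> (\<exists>E\<in>C. v \<in> E \<and> cvec.dim (E \<inter> V0) \<le> i)}" for i
  have U_mono: "U i \<subseteq> U j" if "i \<le> j" for i j using that by (auto simp: U_def)
  have sU: "cvec.subspace (U i)" for i
  proof (rule cvec.subspaceI)
    show "0 \<in> U i" using cvec.subspace_0[OF sV] by (simp add: U_def)
    show "c *\<^sub>C u \<in> U i" if "u \<in> U i" for c u
      using that cvec.subspace_scale[OF sV] cvec.subspace_scale[OF flag_subspace[OF gC]]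
      unfolding U_def by fastforce
    show "u + v \<in> U i" if u: "u \<in> U i" and v: "v \<in> U i" for u v
    proof (cases "u = 0 \<or> v = 0")
      case True
      then show ?thesis using u v by auto
    next
      case False
      then obtain E E' where E: "E \<in> C" "u \<in> E" "cvec.dim (E \<inter> V0) \<le> i" "E' \<in> C" "v \<in> E'" "cvec.dim (E' \<inter> V0) \<le> i"
        using u v by (auto simp: U_def)
      then obtain K where K: "K \<in> C" "u \<in> K" "v \<in> K" "cvec.dim (K \<inter> V0) \<le> i"
        using chC by blast
      have "u + v \<in> K" using K flag_subspace[OF gC K(1)] by (intro cvec.subspace_add)
      moreover have "u + v \<in> V0" using u v sV by (auto simp: U_def intro: cvec.subspace_add)
      ultimately show ?thesis using K by (auto simp: U_def)
    qed
  qed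
  have dim_pos: "0 < cvec.dim (E \<inter> V0)" if "E \<in> C" "v \<in> E" "v \<in> V0" "v \<noteq> 0" for E v
  proof -
    have "{0} \<subset> E \<inter> V0" using that cvec.subspace_0[OF sub[OF that(1)]] by blast
    then have "cvec.dim {0 :: 'v} < cvec.dim (E \<inter> V0)" by (rule dim_strict_mono[OF fin[OF that(1)] cvec.subspace_single_0])
    then show ?thesis by linarith
  qed
  have U0: "U 0 = {0}" using dim_pos cvec.subspace_0[OF sV] by (fastforce simp: U_def)
  define d where "d = cvec.dim V0"
  have Ud: "v \<in> U d" if v: "v \<in> V0" for v
  proof (cases "v = 0")
    case False
    obtain F G where FG: "imm_pair C F G" "v \<in> G" "v \<notin> F" by (rule flag_pair[OF gC False])
    then have G: "G \<in> C" by (simp add: imm_pair_def)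
    have "cvec.dim (G \<inter> V0) \<le> d"
    proof (cases "G \<inter> V0 = V0")
      case False
      then have "G \<inter> V0 \<subset> V0" by blast
      then show ?thesis using dim_strict_mono[OF V0 sub[OF G]] by (simp add: d_def)
    qed (simp add: d_def)
    then show ?thesis using v G FG by (auto simp: U_def)
  qed (use v in \<open>simp add: U_def\<close>)
  have lower: "act (br X Y) v \<in> U i" if XY: "X \<in> H" "Y \<in> H" and v: "v \<in> U (Suc i)" for X Y v i
  proof (cases "v = 0")
    case True
    then show ?thesis using cvec.subspace_0[OF sU] by (simp add: act_right)
  next
    case False
    then obtain E where E: "E \<in> C" "v \<in> E" "cvec.dim (E \<inter> V0) \<le> Suc i" and vV: "v \<in> V0"
      using v by (auto simp: U_def)
    obtain F G where FG: "imm_pair C F G" "v \<in> G" "v \<notin> F" by (rule flag_pair[OF gC False])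
    have F: "F \<in> C" "F \<subseteq> G" using FG by (auto simp: imm_pair_def)
    have "G \<subseteq> E" using imm_pair_cases(1)[OF chC FG(1) _ E(1,2)] FG by blast
    then have "F \<inter> V0 \<subset> E \<inter> V0" using F FG E vV by blast
    then have "cvec.dim (F \<inter> V0) \<le> i" using dim_strict_mono[OF fin[OF E(1)] sub[OF F(1)]] E(3) by linarith
    moreover have "act (br X Y) v \<in> F"
      using stabilizer_commutator_lowers[OF C _ _ FG(1,2)] XY H(2) by blast
    moreover have "act (br X Y) v \<in> V0" using H(1,3) XY by (simp add: lie_subalgebra_def)
    ultimately show ?thesis using F by (auto simp: U_def)
  qed
  define N where "N k = {X. (\<forall>v. act X v \<in> V0) \<and> (\<forall>i. \<forall>v\<in>U i. act X v \<in> U (i - k))}" for k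
  have sN: "cvec.subspace (N k)" for k
    using sU sV unfolding N_def cvec.subspace_def by (auto simp: act_left)
  have step: "(derived_algebra br ^^ Suc k) H \<subseteq> N (Suc k)" for k
  proof (induction k)
    case 0
    have "br X Y \<in> N (Suc 0)" if "X \<in> H" "Y \<in> H" for X Y
    proof -
      have "act (br X Y) v \<in> U (i - Suc 0)" if "v \<in> U i" for i v
        using lower[OF \<open>X \<in> H\<close> \<open>Y \<in> H\<close>] that U0 by (cases i) (auto simp: act_right)
      moreover have "act (br X Y) v \<in> V0" for v using H(1,3) that by (simp add: lie_subalgebra_def)
      ultimately show ?thesis by (simp add: N_def)
    qed
    then show ?case
      unfolding derived_algebra_def funpow.simps comp_def
      by (intro cvec.span_minimal sN) auto
  next
    case (Suc k)
    have "br X Y \<in> N (Suc (Suc k))" if "X \<in> N (Suc k)" "Y \<in> N (Suc k)" for X Y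
    proof -
      have "act T (act S v) \<in> U (i - Suc (Suc k))"
        if "v \<in> U i" "T \<in> N (Suc k)" "S \<in> N (Suc k)" for i v T S
      proof -
        have "act T (act S v) \<in> U (i - Suc k - Suc k)" using that unfolding N_def by blast
        moreover have "U (i - Suc k - Suc k) \<subseteq> U (i - Suc (Suc k))" by (rule U_mono) simp
        ultimately show ?thesis by blast
      qed
      then show ?thesis using that sU sV by (auto simp: N_def act_br intro!: cvec.subspace_diff)
    qed
    then have "derived_algebra br (N (Suc k)) \<subseteq> N (Suc (Suc k))"
      unfolding derived_algebra_def by (intro cvec.span_minimal sN) auto
    then show ?case using derived_algebra_mono[OF Suc] by (simp only: funpow.simps comp_def) blast
  qed
  have "br X Y = 0" if XY: "X \<in> N (Suc d)" "Y \<in> N (Suc d)" for X Y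
  proof (rule act_faithful)
    have "act T (act S u) = 0" if "T \<in> N (Suc d)" "S \<in> N (Suc d)" for T S u
    proof -
      have "act S u \<in> U d" using Ud that by (auto simp: N_def)
      then have "act T (act S u) \<in> U (d - Suc d)" using that(1) unfolding N_def by blast
      then show ?thesis using U0 by simp
    qed
    then show "act (br X Y) u = 0" for u using XY by (simp add: act_br)
  qed
  then have "derived_algebra br (N (Suc d)) \<subseteq> {0}"
    unfolding derived_algebra_def by (intro cvec.span_minimal) auto
  then have "(derived_algebra br ^^ Suc (Suc d)) H \<subseteq> {0}"
    using derived_algebra_mono[OF step[of d], of br] by (simp only: funpow.simps comp_def)
  moreover have "0 \<in> (derived_algebra br ^^ Suc (Suc d)) H"
    by (simp add: derived_algebra_def cvec.span_zero)
  ultimately show ?thesis unfolding solvable_algebra_def by blast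
qed

lemma locally_solvable_stabilizer:
  assumes C: "closed_flag p C" "line_pairs C"
  shows "locally_solvable_algebra br (stabilizer p C)"
proof -
  have lieS: "lie_subalgebra br (stabilizer p C)"
    using lie_subalgebra_stabilizer flag_subspace[OF closed_flagD(1)[OF C(1)]] by blast
  have "\<exists>H. lie_subalgebra br H \<and> H \<subseteq> stabilizer p C \<and> S \<subseteq> H \<and> finite_dim H \<and> solvable_algebra br H"
    if S: "finite S" "S \<subseteq> stabilizer p C" for S
  proof -
    obtain A B where AB: "finite A" "finite B" "S \<subseteq> cvec.span {a \<otimes>\<^sub>t b | a b. a \<in> A \<and> b \<in> B}"
      using tensor_in_finite_product[OF S(1)] by blast
    define T where "T = cvec.span {a \<otimes>\<^sub>t b | a b. a \<in> A \<and> b \<in> B}"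
    have "{a \<otimes>\<^sub>t b | a b. a \<in> A \<and> b \<in> B} = (\<lambda>(a, b). a \<otimes>\<^sub>t b) ` (A \<times> B)" by auto
    then have "finite {a \<otimes>\<^sub>t b | a b. a \<in> A \<and> b \<in> B}" using AB by simp
    then have fT: "finite_dim T" unfolding T_def finite_dim_def by blast
    have sT: "cvec.subspace T" by (simp add: T_def)
    have brT: "br X Y \<in> T" if "X \<in> T" "Y \<in> T" for X Y
      using that span_tens_mult_closed sT unfolding T_def gl_bracket_def by (intro cvec.subspace_diff) auto
    define H where "H = stabilizer p C \<inter> T"
    have sH: "cvec.subspace H"
      unfolding H_def using lieS sT by (intro cvec.subspace_inter) (auto simp: lie_subalgebra_def)
    then have lieH: "lie_subalgebra br H" using lieS brT by (auto simp: lie_subalgebra_def H_def)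
    have "act X v \<in> cvec.span A" if "X \<in> H" for X v
    proof (rule clinear_span_image_subset[OF clinear_gl_act[OF bilinear] cvec.subspace_span])
      show "X \<in> cvec.span {a \<otimes>\<^sub>t b | a b. a \<in> A \<and> b \<in> B}" using that by (simp add: H_def T_def)
      show "act x v \<in> cvec.span A" if "x \<in> {a \<otimes>\<^sub>t b | a b. a \<in> A \<and> b \<in> B}" for x
        using that by (auto simp: act_tens intro!: cvec.span_scale intro: cvec.span_base)
    qed
    moreover have "finite_dim (cvec.span A)" using AB(1) by (auto simp: finite_dim_def)
    moreover have "H \<subseteq> stabilizer p C" by (simp add: H_def)
    ultimately have "solvable_algebra br H" using stabilizer_finite_part_solvable[OF C _ lieH] by blast
    moreover have "finite_dim H" by (rule finite_dim_subset[OF fT sH]) (simp add: H_def)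
    moreover have "S \<subseteq> H" using S AB by (auto simp: H_def T_def)
    ultimately show ?thesis using lieH \<open>H \<subseteq> stabilizer p C\<close> by blast
  qed
  then show ?thesis
    unfolding locally_solvable_algebra_def locally_finite_algebra_def using lieS by meson
qed

lemma tens_in_sl:
  assumes "p v w = 0"
  shows "v \<otimes>\<^sub>t w \<in> sl p"
proof (cases "v = 0")
  case True
  then show ?thesis by (simp add: sl_def derived_algebra_def cvec.span_zero)
next
  case False
  then obtain w1 where w1: "p v w1 \<noteq> 0" using pair_nondegenerate(1) by blast
  define w' where "w' = inverse (p v w1) *\<^sub>C w1"
  have "br (v \<otimes>\<^sub>t w') (v \<otimes>\<^sub>t w) = v \<otimes>\<^sub>t w"
    using w1 assms by (simp add: gl_bracket_def gl_mult_tens[OF bilinear] w'_def pair_simps)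
  then have "v \<otimes>\<^sub>t w \<in> {br X Y | X Y. X \<in> UNIV \<and> Y \<in> UNIV}" by (metis (mono_tags, lifting) UNIV_I mem_Collect_eq)
  then show ?thesis unfolding sl_def derived_algebra_def by (rule cvec.span_base)
qed

lemma stabilizer_subset_refines:
  assumes C: "closed_flag p C" "line_pairs C" and D: "closed_flag p D"
    and sub: "stabilizer p C \<subseteq> stabilizer p D"
  shows "refines C D"
proof -
  note gC = closed_flagD(1)[OF C(1)] and gD = closed_flagD(1)[OF D]
  note chC = flag_chain[OF gC] and chD = flag_chain[OF gD]
  have step: "G \<subseteq> E" if E: "E \<in> D" "pclosure p E = E" "x \<in> E" and FG: "imm_pair C F G" "x \<in> G" "x \<notin> F" for E x F G
  proof -
    have FC: "F \<in> C" using FG(1) by (simp add: imm_pair_def)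
    have sE: "cvec.subspace E" using flag_subspace[OF gD] E by blast
    have "y \<in> E" if y: "y \<in> F" for y
    proof (cases "y = 0")
      case True
      then show ?thesis using cvec.subspace_0[OF sE] by simp
    next
      case False
      obtain F1 G1 where 1: "imm_pair C F1 G1" "y \<in> G1" "y \<notin> F1" by (rule flag_pair[OF gC False])
      then have G1C: "G1 \<in> C" by (simp add: imm_pair_def)
      have "G1 \<subseteq> F" using imm_pair_cases(1)[OF chC 1(1) _ FC y] 1 by blast
      then have "x \<notin> G1" using FG by blast
      then obtain w where w: "w \<in> perp p G1" "p x w = 1" using not_in_closed[OF closed_flagD(2)[OF C(1) 1(1)]] by blast
      have "act (y \<otimes>\<^sub>t w) v \<in> K" if K: "K \<in> C" "v \<in> K" for K v
      proof (cases "K \<subseteq> G1")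
        case True
        then have "p v w = 0" using K w by (auto simp: perp_def)
        then show ?thesis using cvec.subspace_0[OF flag_subspace[OF gC K(1)]] by (simp add: act_tens)
      next
        case False
        then have "y \<in> K" using chC K(1) G1C 1(2) by blast
        then show ?thesis using flag_subspace[OF gC K(1)] by (simp add: act_tens cvec.subspace_scale)
      qed
      moreover have "y \<otimes>\<^sub>t w \<in> sl p" by (rule tens_in_sl) (use w 1 in \<open>auto simp: perp_def\<close>)
      ultimately have "y \<otimes>\<^sub>t w \<in> stabilizer p C" by (simp add: stabilizer_iff)
      then have "y \<otimes>\<^sub>t w \<in> stabilizer p D" using sub by blast
      then have "act (y \<otimes>\<^sub>t w) x \<in> E" using E by (auto simp: stabilizer_iff)
      then show ?thesis using w by (simp add: act_tens)
    qed
    then have FE: "F \<subseteq> E" by blast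
    show ?thesis
    proof (cases "pclosure p F = F")
      case True
      then have "G = cvec.span (insert x F)" using C(2) FG unfolding line_pairs_def by blast
      moreover have "cvec.span (insert x F) \<subseteq> E" by (rule cvec.span_minimal) (use FE E(3) sE in auto)
      ultimately show ?thesis by simp
    next
      case False
      then have "pclosure p F = G" using closed_flagD(3)[OF C(1) FG(1)] by blast
      then show ?thesis using pclosure_minimal[OF FE E(2)] by blast
    qed
  qed
  show ?thesis
    unfolding refines_def
  proof (intro allI impI)
    fix x E1 E2 F G
    assume "x \<noteq> 0 \<and> imm_pair D E1 E2 \<and> x \<in> E2 - E1 \<and> imm_pair C F G \<and> x \<in> G - F"
    then have x: "x \<noteq> 0" and E: "imm_pair D E1 E2" "x \<in> E2" "x \<notin> E1" and FG: "imm_pair C F G" "x \<in> G" "x \<notin> F" by auto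
    have mem: "E1 \<in> D" "E2 \<in> D" "F \<in> C" using E FG by (auto simp: imm_pair_def)
    have "z \<in> F" if z: "z \<in> E1" for z
    proof (cases "z = 0")
      case True
      then show ?thesis using cvec.subspace_0[OF flag_subspace[OF gC mem(3)]] by simp
    next
      case False
      obtain E1' E2' where E': "imm_pair D E1' E2'" "z \<in> E2'" "z \<notin> E1'" by (rule flag_pair[OF gD False])
      obtain F1 G1 where 1: "imm_pair C F1 G1" "z \<in> G1" "z \<notin> F1" by (rule flag_pair[OF gC False])
      have mem': "E2' \<in> D" "G1 \<in> C" using E' 1 by (auto simp: imm_pair_def)
      have "E2' \<subseteq> E1" using imm_pair_cases(1)[OF chD E'(1) _ mem(1) z] E' by blast
      moreover have "G1 \<subseteq> E2'" by (rule step[OF mem'(1) closed_flagD(2)[OF D E'(1)] E'(2) 1])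
      ultimately have "x \<notin> G1" using E by blast
      then have "G1 \<subseteq> F" using imm_pair_cases(2)[OF chC FG(1) _ mem'(2)] FG by blast
      then show ?thesis using 1 by blast
    qed
    moreover have "G \<subseteq> E2" by (rule step[OF mem(2) closed_flagD(2)[OF D E(1)] E(2) FG])
    ultimately show "E1 \<subseteq> F \<and> G \<subseteq> E2" by blast
  qed
qed

lemma stabilizer_subset_eq:
  assumes "maximal_closed_flag p C" "maximal_closed_flag p D" "stabilizer p C \<subseteq> stabilizer p D"
  shows "C = D"
  using stabilizer_subset_refines[OF _ maximal_closed_flag_line_pairs[OF assms(1)] _ assms(3)] assms(1,2)
  unfolding maximal_closed_flag_def by blast

lemma locally_solvable_stabilizes_maximal_flag:
  assumes B: "locally_solvable_algebra br B" "B \<subseteq> sl p"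
  obtains C where "maximal_closed_flag p C" "B \<subseteq> stabilizer p C"
proof -
  obtain D where D: "closed_flag p D" "\<And>E. E \<in> D \<Longrightarrow> stable B E"
    "\<And>F G. imm_pair D F G \<Longrightarrow> pclosure p F = F \<Longrightarrow> closed_irreducible B F G"
    by (rule maximal_chain_flag[of "{}" B]) auto
  have "line_pairs D"
    unfolding line_pairs_def using closed_irreducible_line[OF B(1) D(3)] by blast
  then have "maximal_closed_flag p D" by (rule maximal_closed_flag_if_line_pairs[OF D(1)])
  moreover have "B \<subseteq> stabilizer p D" using B(2) D(2) by (auto simp: stabilizer_iff stable_def)
  ultimately show thesis by (rule that)
qed

lemma borel_stabilizer:
  assumes C: "maximal_closed_flag p C"
  shows "borel_subalgebra br (sl p) (stabilizer p C)"
proof -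
  have cC: "closed_flag p C" using C by (simp add: maximal_closed_flag_def)
  have "lie_subalgebra br (stabilizer p C)"
    using lie_subalgebra_stabilizer flag_subspace[OF closed_flagD(1)[OF cC]] by blast
  moreover have "stabilizer p C \<subseteq> sl p" by (auto simp: stabilizer_iff)
  moreover have "locally_solvable_algebra br (stabilizer p C)"
    by (rule locally_solvable_stabilizer[OF cC maximal_closed_flag_line_pairs[OF C]])
  moreover have "B' = stabilizer p C"
    if B': "B' \<subseteq> sl p" "locally_solvable_algebra br B'" "stabilizer p C \<subseteq> B'" for B'
  proof -
    obtain D where D: "maximal_closed_flag p D" "B' \<subseteq> stabilizer p D"
      by (rule locally_solvable_stabilizes_maximal_flag[OF B'(2,1)])
    then have "C = D" using stabilizer_subset_eq[OF C] B'(3) by blast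
    then show ?thesis using D B' by blast
  qed
  ultimately show ?thesis unfolding borel_subalgebra_def by blast
qed

lemma borel_is_stabilizer:
  assumes B: "borel_subalgebra br (sl p) B"
  obtains C where "maximal_closed_flag p C" "B = stabilizer p C"
proof -
  have loc: "locally_solvable_algebra br B" "B \<subseteq> sl p" using B by (auto simp: borel_subalgebra_def)
  obtain C where C: "maximal_closed_flag p C" "B \<subseteq> stabilizer p C"
    by (rule locally_solvable_stabilizes_maximal_flag[OF loc])
  have "stabilizer p C = B" using borel_stabilizer[OF C(1)] B C(2) unfolding borel_subalgebra_def by blast
  then show thesis using that C by blast
qed

end

theorem theorem4p3:
  fixes p :: "'v::cvector \<Rightarrow> 'w::cvector \<Rightarrow> complex"
  assumes "countably_infinite_dim (UNIV :: 'v set)"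
    and "countably_infinite_dim (UNIV :: 'w set)"
    and "nondegenerate_pairing p"
  shows "(\<forall>B. lie_subalgebra (gl_bracket p) B \<and> B \<subseteq> sl p \<longrightarrow>
            (borel_subalgebra (gl_bracket p) (sl p) B \<longleftrightarrow>
              (\<exists>C. maximal_closed_flag p C \<and> B = stabilizer p C))) \<and>
         bij_betw (stabilizer p) {C. maximal_closed_flag p C}
           {B. borel_subalgebra (gl_bracket p) (sl p) B}"
proof -
  interpret pairing p by standard (rule assms(3))
  have "bij_betw (stabilizer p) {C. maximal_closed_flag p C}
      {B. borel_subalgebra (gl_bracket p) (sl p) B}"
  proof (rule bij_betw_imageI)
    show "inj_on (stabilizer p) {C. maximal_closed_flag p C}"
      using stabilizer_subset_eq by (auto simp: inj_on_def)
    show "stabilizer p ` {C. maximal_closed_flag p C} = {B. borel_subalgebra br (sl p) B}"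
      using borel_stabilizer borel_is_stabilizer by (auto simp: image_iff) metis
  qed
  moreover have "borel_subalgebra br (sl p) B \<longleftrightarrow> (\<exists>C. maximal_closed_flag p C \<and> B = stabilizer p C)" for B
    using borel_stabilizer borel_is_stabilizer by metis
  ultimately show ?thesis by blast
qed

end
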